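(* Fix $\alpha\in(0,\infty)$ and $n\in\mathbb N$. Let $\mathcal P$ be a nonempty convex set of probability measures on a measurable space $(\mathcal X,\mathcal F)$ that is dominated by a $\sigma$-finite measure, and let $\theta:\mathcal P\to\mathbb R$ be linear (i.e. $\theta(\lambda P_0+(1-\lambda)P_1)=\lambda\theta(P_0)+(1-\lambda)\theta(P_1)$ for $P_0,P_1\in\mathcal P$, $\lambda\in[0,1]$) and bounded, $\sup_{P\in\mathcal P}|\theta(P)|<\infty$. Let $l:[0,\infty)\to[0,\infty)$ be non-decreasing with $l(0)=0$ and $l(\frac32t)\le a\,l(t)$ for all $t\ge0$, for some $a\in(1,\infty)$. Then $$\mathcal M_{n,\alpha}(\mathcal P,\theta)\;\le\; C_1\cdot l\left(\omega_{TV}\left(\frac{4}{\sqrt n}\,\frac{e^\alpha+1}{e^\alpha-1}\right)\right),$$ where $$C_1=\left[1+\frac{8a^2}{2a-1}\right]a^{\lceil 2\log(C)/\log(3/2)\rceil+1},\qquad C=\sqrt{2\log(2a)}+1.$$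
   Context: $\omega_{TV}(\varepsilon)=\sup\{|\theta(P_0)-\theta(P_1)|:d_{TV}(P_0,P_1)\le\varepsilon,\ P_0,P_1\in\mathcal P\}$ with $d_{TV}(P_0,P_1)=\sup_A|P_0(A)-P_1(A)|$. Channels. For $q\in\mathbb N$ let $\mathcal Z=\mathbb R^q$ with its Borel sets. A channel $Q$ is a Markov kernel from $\mathcal X^n$ to $\mathcal Z^n$; $QP^{\otimes n}$ denotes the measure $A\mapsto\int Q(A|x)\,dP^{\otimes n}(x)$. $Q$ is $\alpha$-sequentially interactive if there are Markov kernels $Q_i$ from $\mathcal X\times\mathcal Z^{i-1}$ to $\mathcal Z$, $i=1,\dots,n$, such that for all Borel $A\subseteq\mathcal Z^n$ and $x_1,\dots,x_n\in\mathcal X$, $$Q(A|x_1,\dots,x_n)=\int_{\mathcal Z}\cdots\int_{\mathcal Z}Q_n(A_{z_{1:n-1}}|x_n,z_{1:n-1})\,Q_{n-1}(dz_{n-1}|x_{n-1},z_{1:n-2})\cdots Q_1(dz_1|x_1),$$ where $A_{z_{1:n-1}}=\{z\in\mathcal Z:(z_1,\dots,z_{n-1},z)\in A\}$, and such that for every $i$, all Borel $A\subseteq\mathcal Z$, all $x_i,x_i'\in\mathcal X$ and all $z_1,\dots,z_{i-1}$: $Q_i(A|x_i,z_{1:i-1})\le e^\alpha Q_i(A|x_i',z_{1:i-1})$. Let $\mathcal Q_\alpha$ be the set of all $\alpha$-sequentially interactive channels (over all $q\in\mathbb N$). Risk. $\mathcal M_n(Q,\mathcal P,\theta)=\inf_{\hat\theta_n}\sup_{P\in\mathcal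 P}\mathbb E_{QP^{\otimes n}}[l(|\hat\theta_n-\theta(P)|)]$, the infimum being over all (measurable) estimators $\hat\theta_n:\mathcal Z^n\to\mathbb R$, and $\mathcal M_{n,\alpha}(\mathcal P,\theta)=\inf_{Q\in\mathcal Q_\alpha}\mathcal M_n(Q,\mathcal P,\theta)$. *)

theory Defs
  imports "HOL-Probability.Probability"
begin

section \<open>Total variation modulus of continuity\<close>

text \<open>Measures in a family are measures on one common measurable space \<open>M\<close>; of \<open>M\<close> only
  \<^term>\<open>space M\<close> and \<^term>\<open>sets M\<close> matter.\<close>

definition tv_dist :: "'a measure \<Rightarrow> 'a measure \<Rightarrow> real" where
  "tv_dist P0 P1 = (SUP A\<in>sets P0. \<bar>measure P0 A - measure P1 A\<bar>)"

text \<open>A supremum of reals; it is meaningful for \<open>\<epsilon> \<ge> 0\<close> and \<open>\<theta>\<close> bounded on a nonempty \<open>\<P>\<close>.\<close>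

definition omega_TV :: "'a measure set \<Rightarrow> ('a measure \<Rightarrow> real) \<Rightarrow> real \<Rightarrow> real" where
  "omega_TV \<P> \<theta> \<epsilon> =
     Sup {\<bar>\<theta> P0 - \<theta> P1\<bar> | P0 P1. P0 \<in> \<P> \<and> P1 \<in> \<P> \<and> tv_dist P0 P1 \<le> \<epsilon>}"

section \<open>Convexity and linearity\<close>

definition mixture :: "real \<Rightarrow> 'a measure \<Rightarrow> 'a measure \<Rightarrow> 'a measure" where
  "mixture c P0 P1 = measure_of (space P0) (sets P0)
     (\<lambda>A. ennreal c * emeasure P0 A + ennreal (1 - c) * emeasure P1 A)"

lemma sets_mixture [simp]: "sets (mixture c P0 P1) = sets P0"
  by (simp add: mixture_def)

lemma space_mixture [simp]: "space (mixture c P0 P1) = space P0"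
  by (simp add: mixture_def)

lemma emeasure_mixture:
  assumes "sets P1 = sets P0"
  shows "emeasure (mixture c P0 P1) A =
           ennreal c * emeasure P0 A + ennreal (1 - c) * emeasure P1 A"
proof (cases "A \<in> sets P0")
  case True
  show ?thesis
  proof (rule emeasure_measure_of[OF mixture_def])
    show "countably_additive (sets (mixture c P0 P1))
       (\<lambda>A. ennreal c * emeasure P0 A + ennreal (1 - c) * emeasure P1 A)"
    proof (rule countably_additiveI)
      fix F :: "nat \<Rightarrow> 'a set"
      assume F: "range F \<subseteq> sets (mixture c P0 P1)" "disjoint_family F"
      have 0: "(\<Sum>i. emeasure P0 (F i)) = emeasure P0 (\<Union>i. F i)"
        using F by (intro suminf_emeasure) auto
      have 1: "(\<Sum>i. emeasure P1 (F i)) = emeasure P1 (\<Union>i. F i)"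
        using F assms by (intro suminf_emeasure) auto
      show "(\<Sum>i. ennreal c * emeasure P0 (F i) + ennreal (1 - c) * emeasure P1 (F i)) =
            ennreal c * emeasure P0 (\<Union>i. F i) + ennreal (1 - c) * emeasure P1 (\<Union>i. F i)"
        by (simp add: suminf_add[symmetric] 0 1)
    qed
  qed (use True sets.space_closed in \<open>auto simp: positive_def\<close>)
next
  case False
  then show ?thesis
    using assms by (simp add: emeasure_notin_sets)
qed

definition convex_measures :: "'a measure set \<Rightarrow> bool" where
  "convex_measures \<P> \<longleftrightarrow>
     (\<forall>P0\<in>\<P>. \<forall>P1\<in>\<P>. \<forall>c\<in>{0..1}. mixture c P0 P1 \<in> \<P>)"

definition linear_functional_on :: "'a measure set \<Rightarrow> ('a measure \<Rightarrow> real) \<Rightarrow> bool" where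
  "linear_functional_on \<P> \<theta> \<longleftrightarrow>
     (\<forall>P0\<in>\<P>. \<forall>P1\<in>\<P>. \<forall>c\<in>{0..1}. \<theta> (mixture c P0 P1) = c * \<theta> P0 + (1 - c) * \<theta> P1)"

definition dominated_measures :: "'a measure \<Rightarrow> 'a measure set \<Rightarrow> bool" where
  "dominated_measures M \<P> \<longleftrightarrow>
     (\<exists>\<mu>. sigma_finite_measure \<mu> \<and> sets \<mu> = sets M \<and> (\<forall>P\<in>\<P>. absolutely_continuous \<mu> P))"

section \<open>Sequentially interactive private channels\<close>

text \<open>All indices are shifted to start at 0: a point of \<open>\<Z>\<^sup>k\<close> is an extensional function on
  \<open>{..<k}\<close>, and the kernel \<open>K i\<close> releases the \<open>i\<close>-th private view \<open>z i\<close> (with \<open>i < n\<close>) from \<open>x i\<close>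
  and the earlier views \<open>z 0, \<dots>, z (i - 1)\<close>. Markov kernels from \<open>M\<close> to \<open>N\<close> are the elements of
  \<^term>\<open>M \<rightarrow>\<^sub>M prob_algebra N\<close>.\<close>

definition view_space :: "nat \<Rightarrow> (nat \<Rightarrow> real) measure" where
  "view_space q = (\<Pi>\<^sub>M j\<in>{..<q}. borel)"

abbreviation views :: "nat \<Rightarrow> nat \<Rightarrow> (nat \<Rightarrow> nat \<Rightarrow> real) measure" where
  "views q k \<equiv> (\<Pi>\<^sub>M i\<in>{..<k}. view_space q)"

definition channels ::
  "'a measure \<Rightarrow> nat \<Rightarrow> nat \<Rightarrow> ((nat \<Rightarrow> 'a) \<Rightarrow> (nat \<Rightarrow> nat \<Rightarrow> real) measure) set" where
  "channels M n q = (\<Pi>\<^sub>M i\<in>{..<n}. M) \<rightarrow>\<^sub>M prob_algebra (views q n)"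

text \<open>With the views \<open>z 0, \<dots>, z (k - 1)\<close> already released, \<open>iterated_kernel q K x A m k z\<close> integrates
  over the next \<open>m\<close> views and evaluates the kernel of the last view, number \<open>k + m\<close>, at the section
  of \<open>A\<close>. The full iterated integral is therefore the case \<open>m = n - 1\<close>, \<open>k = 0\<close>, with \<open>z\<close> the
  empty tuple.\<close>

primrec iterated_kernel ::
  "nat \<Rightarrow> (nat \<Rightarrow> 'a \<times> (nat \<Rightarrow> nat \<Rightarrow> real) \<Rightarrow> (nat \<Rightarrow> real) measure) \<Rightarrow> (nat \<Rightarrow> 'a) \<Rightarrow>
   (nat \<Rightarrow> nat \<Rightarrow> real) set \<Rightarrow> nat \<Rightarrow> nat \<Rightarrow> (nat \<Rightarrow> nat \<Rightarrow> real) \<Rightarrow> ennreal" where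
  "iterated_kernel q K x A 0 k z =
     emeasure (K k (x k, z)) {y \<in> space (view_space q). z(k := y) \<in> A}"
| "iterated_kernel q K x A (Suc m) k z =
     (\<integral>\<^sup>+ y. iterated_kernel q K x A m (Suc k) (z(k := y)) \<partial>K k (x k, z))"

definition seq_interactive ::
  "real \<Rightarrow> 'a measure \<Rightarrow> nat \<Rightarrow> nat \<Rightarrow> ((nat \<Rightarrow> 'a) \<Rightarrow> (nat \<Rightarrow> nat \<Rightarrow> real) measure) \<Rightarrow> bool" where
  "seq_interactive \<alpha> M n q Q \<longleftrightarrow>
     (\<exists>K. (\<forall>i<n. K i \<in> (M \<Otimes>\<^sub>M views q i) \<rightarrow>\<^sub>M prob_algebra (view_space q)) \<and>
          (\<forall>A\<in>sets (views q n). \<forall>x\<in>space (\<Pi>\<^sub>M i\<in>{..<n}. M).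
             emeasure (Q x) A = iterated_kernel q K x A (n - 1) 0 (\<lambda>_. undefined)) \<and>
          (\<forall>i<n. \<forall>A\<in>sets (view_space q). \<forall>x\<in>space M. \<forall>x'\<in>space M. \<forall>z\<in>space (views q i).
             measure (K i (x, z)) A \<le> exp \<alpha> * measure (K i (x', z)) A))"

section \<open>Minimax risk\<close>

text \<open>\<^term>\<open>(\<Pi>\<^sub>M i\<in>{..<n}. P) \<bind> Q\<close> is the measure \<open>A \<mapsto> \<integral> Q(A|x) dP\<^sup>\<otimes>\<^sup>n(x)\<close>. Risks are extended
  nonnegative reals, so that infinite expectations are allowed.\<close>

definition minimax_risk ::
  "(real \<Rightarrow> real) \<Rightarrow> nat \<Rightarrow> nat \<Rightarrow> ((nat \<Rightarrow> 'a) \<Rightarrow> (nat \<Rightarrow> nat \<Rightarrow> real) measure) \<Rightarrow>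
   'a measure set \<Rightarrow> ('a measure \<Rightarrow> real) \<Rightarrow> ennreal" where
  "minimax_risk l n q Q \<P> \<theta> =
     (INF est\<in>borel_measurable (views q n).
        SUP P\<in>\<P>. \<integral>\<^sup>+ z. ennreal (l \<bar>est z - \<theta> P\<bar>) \<partial>((\<Pi>\<^sub>M i\<in>{..<n}. P) \<bind> Q))"

definition private_minimax_risk ::
  "(real \<Rightarrow> real) \<Rightarrow> nat \<Rightarrow> real \<Rightarrow> 'a measure \<Rightarrow> 'a measure set \<Rightarrow> ('a measure \<Rightarrow> real) \<Rightarrow> ennreal" where
  "private_minimax_risk l n \<alpha> M \<P> \<theta> =
     (INF q\<in>{1..}. INF Q\<in>{Q \<in> channels M n q. seq_interactive \<alpha> M n q Q}.
        minimax_risk l n q Q \<P> \<theta>)"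

end

theory Submission
  imports Defs
begin

text \<open>Write \<open>\<rho> = (e\<^sup>\<alpha> + 1) / (e\<^sup>\<alpha> - 1)\<close>, \<open>\<epsilon> = 4 \<rho> / sqrt n\<close>
  and \<open>w = \<omega>\<^sub>T\<^sub>V \<epsilon>\<close>. By linearity, \<open>\<theta> P - \<theta> Q \<le> w + B \<parallel>P - Q\<parallel>\<^sub>1\<close> with
  \<open>B = w / (2 \<epsilon>)\<close>, and a minimax argument yields a function \<open>\<bar>f\<bar> \<le> B\<close> such that
  \<open>\<theta> P\<close> differs from \<open>\<integral> f dP\<close>, up to an additive constant independent of \<open>P\<close>, by at
  most \<open>3 w / 4\<close>. The \<open>i\<close>-th individual releases \<open>\<plusminus>B \<rho>\<close>, randomised with conditional
  mean \<open>f x\<^sub>i\<close>, which is exactly \<open>\<alpha>\<close>-private. The released values are i.i.d. with mean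
  \<open>\<integral> f dP\<close>, and Hoeffding's inequality bounds the deviation of their average at scale
  \<open>B \<rho> / sqrt n = w / 8\<close>. Summing the loss over the shells
  \<open>(3/2)\<^sup>k w \<le> error \<le> (3/2)\<^sup>k\<^sup>+\<^sup>1 w\<close> gives the risk bound. If \<open>w = 0\<close> then
  \<open>\<theta>\<close> is constant.\<close>

section \<open>Bounded separation in \<open>L\<^sup>1\<close>\<close>

definition clip :: "real \<Rightarrow> real \<Rightarrow> real" where
  "clip B x = max (- B) (min B x)"

lemma abs_clip_le: "0 \<le> B \<Longrightarrow> \<bar>clip B x\<bar> \<le> B"
  by (auto simp: clip_def)

lemma clip_lipschitz: "\<bar>clip B x - clip B y\<bar> \<le> \<bar>x - y\<bar>"
  by (auto simp: clip_def)

lemma borel_measurable_clip [measurable]: "clip B \<in> borel_measurable borel"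
  unfolding clip_def by measurable

text \<open>Completing the square, the objective is \<kappa> times the squared distance to
  \<open>v = g / (2 * \<kappa>)\<close>, up to a constant. Its minimiser over [-B, B] is the
  projection \<open>u\<close> of \<open>v\<close>, and the obtuse-angle inequality
  \<open>(c - u) * (v - u) \<le> 0\<close> yields the extra gap
  \<open>\<kappa> * (c - u)\<^sup>2\<close>.\<close>

lemma clip_strong_min:
  fixes \<kappa> c B g :: real
  assumes "0 < \<kappa>" "\<bar>c\<bar> \<le> B"
  defines "u \<equiv> clip B (g / (2 * \<kappa>))"
  shows "- (g * u) + \<kappa> * u\<^sup>2 + \<kappa> * (c - u)\<^sup>2 \<le> - (g * c) + \<kappa> * c\<^sup>2"
proof -
  define v where "v = g / (2 * \<kappa>)"
  have g: "g = 2 * \<kappa> * v" using assms(1) by (simp add: v_def)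
  have "(c - u) * (v - u) \<le> 0"
    using assms(2) unfolding u_def v_def[symmetric] clip_def
    by (auto simp: max_def min_def mult_nonneg_nonpos mult_nonpos_nonneg mult_le_0_iff)
  then have "2 * \<kappa> * ((c - u) * (v - u)) \<le> 0"
    using assms(1) by (simp add: mult_le_0_iff)
  then show ?thesis
    unfolding g by (simp add: power2_eq_square algebra_simps)
qed

text \<open>Integral and series of absolute values may be interchanged, so the series of absolute
  values has finite integral and is therefore finite almost everywhere.\<close>

lemma AE_summable_of_summable_L1:
  fixes u :: "nat \<Rightarrow> 'a \<Rightarrow> real"
  assumes [measurable]: "\<And>n. u n \<in> borel_measurable M"
    and int: "\<And>n. integrable M (u n)"
    and le: "\<And>n. (\<integral>x. \<bar>u n x\<bar> \<partial>M) \<le> b n" and b: "summable b"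
  shows "AE x in M. summable (\<lambda>n. u n x)"
proof -
  have nn: "0 \<le> b n" for n by (rule order_trans[OF _ le]) simp
  have "(\<integral>\<^sup>+x. (\<Sum>n. ennreal \<bar>u n x\<bar>) \<partial>M) = (\<Sum>n. \<integral>\<^sup>+x. ennreal \<bar>u n x\<bar> \<partial>M)"
    by (rule nn_integral_suminf) simp
  also have "\<dots> = (\<Sum>n. ennreal (\<integral>x. \<bar>u n x\<bar> \<partial>M))"
    using int by (subst nn_integral_eq_integral) auto
  also have "\<dots> \<le> (\<Sum>n. ennreal (b n))"
    by (intro suminf_le ennreal_leI le) auto
  also have "\<dots> < \<infinity>" using b nn by (simp add: suminf_ennreal2)
  finally have "AE x in M. (\<Sum>n. ennreal \<bar>u n x\<bar>) \<noteq> \<infinity>"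
    by (intro nn_integral_noteq_infinite) auto
  then show ?thesis
  proof eventually_elim
    case (elim x)
    then have "summable (\<lambda>n. \<bar>u n x\<bar>)" by (intro summable_suminf_not_top) auto
    then show ?case by (rule summable_rabs_cancel)
  qed
qed

lemma integrable_mult_bounded:
  fixes g f :: "'a \<Rightarrow> real"
  assumes "integrable M g" and [measurable]: "f \<in> borel_measurable M" and "\<And>x. \<bar>f x\<bar> \<le> B"
  shows "integrable M (\<lambda>x. g x * f x)"
proof (rule Bochner_Integration.integrable_bound)
  show "integrable M (\<lambda>x. B * g x)" using assms by simp
  have [measurable]: "g \<in> borel_measurable M" using assms by auto
  show "(\<lambda>x. g x * f x) \<in> borel_measurable M" by measurable
  have "\<bar>g x\<bar> * \<bar>f x\<bar> \<le> \<bar>B\<bar> * \<bar>g x\<bar>" for x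
    using mult_right_mono[OF order_trans[OF assms(3)[of x] abs_ge_self], of "\<bar>g x\<bar>"]
    by (simp add: mult.commute)
  then show "AE x in M. norm (g x * f x) \<le> norm (B * g x)"
    by (simp add: abs_mult)
qed

text \<open>A minimax argument: \<open>f\<close> is the limit of the unique best responses to almost optimal elements
  of \<open>D\<close> in the game with payoff \<open>t - \<integral> g f + \<kappa> \<integral> f\<^sup>2\<close>. The quadratic term makes these
  best responses a Cauchy sequence, so that no Hahn-Banach or weak compactness theorem is
  needed.\<close>

lemma (in finite_measure) bounded_separation:
  fixes D :: "(('a \<Rightarrow> real) \<times> real) set"
  assumes ne: "D \<noteq> {}"
    and int: "\<And>g t. (g, t) \<in> D \<Longrightarrow> integrable M g"
    and bnd: "\<And>g t. (g, t) \<in> D \<Longrightarrow> (\<integral>x. \<bar>g x\<bar> \<partial>M) \<le> R"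
    and conv: "\<And>g t h u s. (g, t) \<in> D \<Longrightarrow> (h, u) \<in> D \<Longrightarrow> 0 \<le> s \<Longrightarrow> s \<le> 1 \<Longrightarrow>
                 ((\<lambda>x. (1 - s) * g x + s * h x), (1 - s) * t + s * u) \<in> D"
    and le: "\<And>g t. (g, t) \<in> D \<Longrightarrow> t \<le> w + B * (\<integral>x. \<bar>g x\<bar> \<partial>M)"
    and B: "0 < B" and \<delta>: "0 < \<delta>"
  obtains f where "f \<in> borel_measurable M" "\<And>x. \<bar>f x\<bar> \<le> B"
    "\<And>g t. (g, t) \<in> D \<Longrightarrow> t \<le> w + \<delta> + (\<integral>x. g x * f x \<partial>M)"
proof -
  \<comment> \<open>Chosen so that the quadratic term costs at most \<delta> for any strategy
    bounded by \<open>B\<close>; the summand 1 keeps the quotient meaningful when the measure is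
    zero.\<close>
  define \<kappa> where "\<kappa> = \<delta> / (B\<^sup>2 * (measure M (space M) + 1))"
  have \<kappa>: "0 < \<kappa>" unfolding \<kappa>_def using B \<delta>
    by (intro divide_pos_pos mult_pos_pos) (auto simp: add_nonneg_pos)
  have "\<kappa> * B\<^sup>2 = \<delta> / (measure M (space M) + 1)" using B by (simp add: \<kappa>_def)
  moreover have "\<delta> / (measure M (space M) + 1) * measure M (space M) \<le> \<delta>"
    using \<delta> measure_nonneg[of M "space M"] by (simp add: field_simps add_pos_nonneg)
  ultimately have \<kappa>B: "\<kappa> * B\<^sup>2 * measure M (space M) \<le> \<delta>" by simp
  define br where "br g = (\<lambda>x. clip B (g x / (2 * \<kappa>)))" for g :: "'a \<Rightarrow> real"
  define F where "F g t f = t - (\<integral>x. g x * f x \<partial>M) + \<kappa> * (\<integral>x. (f x)\<^sup>2 \<partial>M)"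
    for g t and f :: "'a \<Rightarrow> real"
  have gm [measurable_dest]: "g \<in> borel_measurable M" if "(g, t) \<in> D" for g t
    using int[OF that] by auto
  have br_m [measurable]: "br g \<in> borel_measurable M" if "(g, t) \<in> D" for g t
    using gm[OF that] unfolding br_def by measurable
  have br_B: "\<bar>br g x\<bar> \<le> B" for g x using B abs_clip_le by (simp add: br_def)
  have int_sq: "integrable M (\<lambda>x. (f x)\<^sup>2)"
    if [measurable]: "f \<in> borel_measurable M" and "\<And>x. \<bar>f x\<bar> \<le> C" for f :: "'a \<Rightarrow> real" and C
  proof (rule integrable_const_bound)
    show "AE x in M. norm ((f x)\<^sup>2) \<le> C\<^sup>2"
      using power_mono[OF that(2), where n=2] by simp
  qed simp
  \<comment> \<open>Integrated form of \<open>clip_strong_min\<close>: a strategy whose payoff is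
    nearly optimal must be close to \<open>br g\<close> in \<open>L\<^sup>2\<close>.\<close>
  have strong: "F g t (br g) + \<kappa> * (\<integral>x. (c x - br g x)\<^sup>2 \<partial>M) \<le> F g t c"
    if D: "(g, t) \<in> D" and c [measurable]: "c \<in> borel_measurable M" and cB: "\<And>x. \<bar>c x\<bar> \<le> B"
    for g t c
  proof -
    note [measurable] = br_m[OF D]
    have d: "\<bar>c x - br g x\<bar> \<le> 2 * B" for x using cB[of x] br_B[of g x] by linarith
    note ig = integrable_mult_bounded[OF int[OF D]]
    have "(\<integral>x. - (g x * br g x) + \<kappa> * (br g x)\<^sup>2 + \<kappa> * (c x - br g x)\<^sup>2 \<partial>M)
        \<le> (\<integral>x. - (g x * c x) + \<kappa> * (c x)\<^sup>2 \<partial>M)"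
    proof (rule integral_mono)
      show "integrable M (\<lambda>x. - (g x * br g x) + \<kappa> * (br g x)\<^sup>2 + \<kappa> * (c x - br g x)\<^sup>2)"
        using ig[OF br_m[OF D] br_B] int_sq[OF br_m[OF D] br_B] int_sq[OF _ d] by auto
      show "integrable M (\<lambda>x. - (g x * c x) + \<kappa> * (c x)\<^sup>2)"
        using ig[OF c cB] int_sq[OF c cB] by auto
      show "- (g x * br g x) + \<kappa> * (br g x)\<^sup>2 + \<kappa> * (c x - br g x)\<^sup>2 \<le> - (g x * c x) + \<kappa> * (c x)\<^sup>2" for x
        unfolding br_def by (rule clip_strong_min[OF \<kappa> cB])
    qed
    then show ?thesis
      using ig[OF c cB] int_sq[OF c cB] ig[OF br_m[OF D] br_B] int_sq[OF br_m[OF D] br_B] int_sq[OF _ d]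
      by (simp add: F_def)
  qed
  have best: "F g t (br g) \<le> F g t c"
    if "(g, t) \<in> D" "c \<in> borel_measurable M" "\<And>x. \<bar>c x\<bar> \<le> B" for g t c
  proof -
    have "0 \<le> \<kappa> * (\<integral>x. (c x - br g x)\<^sup>2 \<partial>M)" using \<kappa> by simp
    then show ?thesis using strong[OF that] by linarith
  qed
  define V where "V p = F (fst p) (snd p) (br (fst p))" for p
  define S where "S = (SUP p\<in>D. V p)"
  have V_le: "V p \<le> w + \<delta>" if "p \<in> D" for p
  proof -
    obtain g t where p: "p = (g, t)" by (cases p)
    have D: "(g, t) \<in> D" using that p by simp
    note [measurable] = gm[OF D]
    \<comment> \<open>The extremal competitor: it turns the bilinear term into B times the
      \<open>L\<^sup>1\<close> norm of \<open>g\<close>, which is exactly what the hypothesis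
      \<open>le\<close> controls.\<close>
    define c where "c x = B * sgn (g x)" for x
    have c [measurable]: "c \<in> borel_measurable M" unfolding c_def by measurable
    have cB: "\<bar>c x\<bar> \<le> B" for x using B by (simp add: c_def abs_mult sgn_real_def)
    have "V p \<le> F g t c"
      using best[OF D c cB] by (simp add: V_def p)
    also have "\<dots> \<le> t - B * (\<integral>x. \<bar>g x\<bar> \<partial>M) + \<kappa> * (B\<^sup>2 * measure M (space M))"
    proof -
      have "g x * c x = B * \<bar>g x\<bar>" for x by (simp add: c_def sgn_real_def)
      moreover have "(\<integral>x. (c x)\<^sup>2 \<partial>M) \<le> (\<integral>x. B\<^sup>2 \<partial>M)"
        using int_sq[OF c cB] power_mono[OF cB, where n=2] by (intro integral_mono) auto
      ultimately show ?thesis using \<kappa> by (simp add: F_def mult.commute)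
    qed
    also have "\<dots> \<le> w + \<delta>" using le[OF D] \<kappa>B by (simp add: mult.assoc)
    finally show ?thesis .
  qed
  have bdd: "bdd_above (V ` D)" using V_le by (auto intro!: bdd_aboveI)
  have VS: "V p \<le> S" if "p \<in> D" for p unfolding S_def using bdd that by (rule cSUP_upper2) simp
  have S_le: "S \<le> w + \<delta>" unfolding S_def using ne V_le by (intro cSUP_least) auto
  \<comment> \<open>The accuracy \<open>(1/16)^n\<close> is tied to the mixing weight
    \<open>(1/4)^n\<close> below: dividing the first by the second leaves the error
    \<open>(1/4)^n\<close>.\<close>
  have "\<exists>p\<in>D. S - (1/16)^n < V p" for n
    unfolding S_def by (rule less_cSUP_iff[THEN iffD1, OF ne bdd]) simp
  then obtain p where p: "\<And>n. p n \<in> D" "\<And>n. S - (1/16)^n < V (p n)" by metis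
  define g t where "g n = fst (p n)" and "t n = snd (p n)" for n
  have gD: "(g n, t n) \<in> D" for n using p by (simp add: g_def t_def)
  have gV: "S - (1/16)^n < F (g n) (t n) (br (g n))" for n using p(2)[of n] by (simp add: V_def g_def t_def)
  note [measurable] = gm[OF gD] br_m[OF gD]
  define s :: "nat \<Rightarrow> real" where "s n = (1/4)^n" for n
  have s: "0 < s n" "s n \<le> 1" for n by (auto simp: s_def power_le_one)
  \<comment> \<open>The almost optimal element pushed slightly towards an arbitrary
    \<open>h\<close>. Convexity keeps it in \<open>D\<close>, so its value cannot exceed
    \<open>S\<close>.\<close>
  define mix where "mix n h = (\<lambda>x. (1 - s n) * g n x + s n * h x)" for n h
  have mixD: "(mix n h, (1 - s n) * t n + s n * u) \<in> D" if "(h, u) \<in> D" for n h u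
    unfolding mix_def using conv[OF gD that] s less_imp_le by blast
  \<comment> \<open>For a fixed strategy the payoff is affine in the pair \<open>(g, t)\<close>. The
    mixture has value at most \<open>S\<close>, and its \<open>g n\<close> part contributes at least
    \<open>(1 - s n) * (S - (1/16)^n)\<close>; the remainder belongs to \<open>h\<close> and is
    divided by its weight \<open>s n\<close>.\<close>
  have near: "F h u (br (mix n h)) \<le> S + (1/4)^n" if hD: "(h, u) \<in> D" for n h u
  proof -
    let ?f = "br (mix n h)"
    note f [measurable] = br_m[OF mixD[OF hD, of n]]
    have split: "F (mix n h) ((1 - s n) * t n + s n * u) ?f = (1 - s n) * F (g n) (t n) ?f + s n * F h u ?f"
    proof -
      have "(\<integral>x. mix n h x * ?f x \<partial>M) = (\<integral>x. (1 - s n) * (g n x * ?f x) + s n * (h x * ?f x) \<partial>M)"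
        by (intro Bochner_Integration.integral_cong) (auto simp: mix_def algebra_simps)
      also have "\<dots> = (1 - s n) * (\<integral>x. g n x * ?f x \<partial>M) + s n * (\<integral>x. h x * ?f x \<partial>M)"
        using integrable_mult_bounded[OF int[OF gD] f br_B] integrable_mult_bounded[OF int[OF hD] f br_B]
        by simp
      finally show ?thesis by (simp add: F_def algebra_simps)
    qed
    have "F (g n) (t n) (br (g n)) \<le> F (g n) (t n) ?f"
      by (rule best[OF gD f br_B])
    then have "S - (1/16)^n \<le> F (g n) (t n) ?f" using gV[of n] by linarith
    then have "(1 - s n) * (S - (1/16)^n) \<le> (1 - s n) * F (g n) (t n) ?f"
      using s[of n] by (intro mult_left_mono) auto
    then have "(1 - s n) * (S - (1/16)^n) + s n * F h u ?f \<le> S"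
      using VS[OF mixD[OF hD, of n]] split by (simp add: V_def)
    then have "s n * F h u ?f \<le> s n * S + (1 - s n) * (1/16)^n" by (simp add: algebra_simps)
    also have "\<dots> \<le> s n * S + (1/16)^n"
      using s[of n] by (simp add: algebra_simps)
    also have "\<dots> = s n * (S + (1/4)^n)"
      by (simp add: s_def algebra_simps flip: power_mult_distrib)
    finally show ?thesis using s[of n] by (simp add: mult_le_cancel_left_pos)
  qed
  \<comment> \<open>Best responses are Lipschitz in \<open>g\<close> with constant
    \<open>1 / (2 * \<kappa>)\<close>, and \<open>mix n h\<close> differs from \<open>g n\<close> by
    \<open>s n\<close> times \<open>h - g n\<close>, whose \<open>L\<^sup>1\<close> norm is at most
    \<open>2 * R\<close>.\<close>
  have close: "(\<integral>x. \<bar>br (mix n h) x - br (g n) x\<bar> \<partial>M) \<le> s n * (R / \<kappa>)" if hD: "(h, u) \<in> D" for n h u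
  proof -
    note f [measurable] = br_m[OF mixD[OF hD, of n]]
    have ih: "integrable M (\<lambda>x. (s n / (2 * \<kappa>)) * (\<bar>h x\<bar> + \<bar>g n x\<bar>))"
      using int[OF hD] int[OF gD] by auto
    have pw: "\<bar>br (mix n h) x - br (g n) x\<bar> \<le> (s n / (2 * \<kappa>)) * (\<bar>h x\<bar> + \<bar>g n x\<bar>)" for x
    proof -
      have "\<bar>br (mix n h) x - br (g n) x\<bar> \<le> \<bar>mix n h x / (2 * \<kappa>) - g n x / (2 * \<kappa>)\<bar>"
        unfolding br_def by (rule clip_lipschitz)
      also have "\<dots> = \<bar>(s n / (2 * \<kappa>)) * (h x - g n x)\<bar>"
        by (rule arg_cong[where f=abs]) (simp add: mix_def algebra_simps add_divide_distrib diff_divide_distrib)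
      also have "\<dots> = (s n / (2 * \<kappa>)) * \<bar>h x - g n x\<bar>"
        using s[of n] \<kappa> by (simp add: abs_mult)
      also have "\<dots> \<le> (s n / (2 * \<kappa>)) * (\<bar>h x\<bar> + \<bar>g n x\<bar>)"
        using s[of n] \<kappa> by (intro mult_left_mono) auto
      finally show ?thesis .
    qed
    have "(\<integral>x. \<bar>br (mix n h) x - br (g n) x\<bar> \<partial>M) \<le> (\<integral>x. (s n / (2 * \<kappa>)) * (\<bar>h x\<bar> + \<bar>g n x\<bar>) \<partial>M)"
    proof (rule integral_mono[OF _ ih pw])
      show "integrable M (\<lambda>x. \<bar>br (mix n h) x - br (g n) x\<bar>)"
        by (rule Bochner_Integration.integrable_bound[OF ih]) (use pw order_trans[OF pw abs_ge_self] in auto)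
    qed
    also have "\<dots> = (s n / (2 * \<kappa>)) * ((\<integral>x. \<bar>h x\<bar> \<partial>M) + (\<integral>x. \<bar>g n x\<bar> \<partial>M))"
      using int[OF hD] int[OF gD] by simp
    also have "\<dots> \<le> (s n / (2 * \<kappa>)) * (R + R)"
      using s[of n] \<kappa> bnd[OF hD] bnd[OF gD] by (intro mult_left_mono add_mono) auto
    finally show ?thesis by simp
  qed
  have int_d: "integrable M (\<lambda>x. f x - f' x)"
    if [measurable]: "f \<in> borel_measurable M" "f' \<in> borel_measurable M"
      and "\<And>x. \<bar>f x\<bar> \<le> B" "\<And>x. \<bar>f' x\<bar> \<le> B" for f f' :: "'a \<Rightarrow> real"
    using that(3,4) by (intro Bochner_Integration.integrable_diff integrable_const_bound[where B=B]) auto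
  \<comment> \<open>Consecutive best responses are compared through the response to
    \<open>mix n (g (Suc n))\<close>. It is near \<open>br (g n)\<close> by \<open>close\<close>; by
    \<open>near\<close> it is also almost optimal against \<open>g (Suc n)\<close>, so
    \<open>strong\<close> puts it near \<open>br (g (Suc n))\<close>.\<close>
  have step: "(\<integral>x. \<bar>br (g (Suc n)) x - br (g n) x\<bar> \<partial>M)
      \<le> (1/4)^n * (R / \<kappa>) + ((1/2)^n * (2 / \<kappa>) + (1/2)^n * measure M (space M))" for n
  proof -
    let ?f = "br (mix n (g (Suc n)))" and ?h = "br (g (Suc n))"
    note f [measurable] = br_m[OF mixD[OF gD[of "Suc n"], of n]]
    have "F (g (Suc n)) (t (Suc n)) ?h + \<kappa> * (\<integral>x. (?f x - ?h x)\<^sup>2 \<partial>M) \<le> S + (1/4)^n"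
      using strong[OF gD f br_B] near[OF gD] order_trans by blast
    then have "\<kappa> * (\<integral>x. (?f x - ?h x)\<^sup>2 \<partial>M) \<le> (1/4)^n + (1/16)^(Suc n)"
      using gV[of "Suc n"] by linarith
    also have "\<dots> \<le> 2 * (1/4)^n"
    proof -
      have "(1/16::real)^Suc n \<le> (1/16)^n" by simp
      also have "\<dots> \<le> (1/4)^n" by (rule power_mono) auto
      finally show ?thesis by simp
    qed
    finally have sq: "(\<integral>x. (?f x - ?h x)\<^sup>2 \<partial>M) \<le> 2 * (1/4)^n / \<kappa>"
      using \<kappa> by (simp add: field_simps)
    have i2: "integrable M (\<lambda>x. (?f x - ?h x)\<^sup>2)"
    proof (rule int_sq)
      show "\<bar>?f x - ?h x\<bar> \<le> 2 * B" for x
        using br_B[of "mix n (g (Suc n))" x] br_B[of "g (Suc n)" x] by linarith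
    qed simp
    \<comment> \<open>Passes from \<open>L\<^sup>2\<close> to \<open>L\<^sup>1\<close>: with weight
      \<open>2^n\<close>, a squared distance of order \<open>(1/4)^n\<close> becomes a summable
      bound of order \<open>(1/2)^n\<close>.\<close>
    have pw: "\<bar>?f x - ?h x\<bar> \<le> 2^n * (?f x - ?h x)\<^sup>2 + (1/2)^n" for x
    proof -
      have "0 \<le> (2^n * \<bar>?f x - ?h x\<bar> - 1)\<^sup>2 + 2^n * \<bar>?f x - ?h x\<bar>" by simp
      then have "2^n * \<bar>?f x - ?h x\<bar> \<le> 2^n * (2^n * (?f x - ?h x)\<^sup>2 + (1/2)^n)"
        by (simp add: power2_eq_square algebra_simps flip: power_mult_distrib)
      then show ?thesis by (simp only: mult_le_cancel_left_pos[of "2^n::real"] zero_less_power zero_less_numeral)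
    qed
    have if1: "integrable M (\<lambda>x. \<bar>?f x - ?h x\<bar>)"
      using int_d[OF f br_m[OF gD] br_B br_B] by auto
    have if2: "integrable M (\<lambda>x. \<bar>br (mix n (g (Suc n))) x - br (g n) x\<bar>)"
      using int_d[OF f br_m[OF gD] br_B br_B] by auto
    have "(\<integral>x. \<bar>?f x - ?h x\<bar> \<partial>M) \<le> (\<integral>x. 2^n * (?f x - ?h x)\<^sup>2 + (1/2)^n \<partial>M)"
      by (rule integral_mono[OF if1 _ pw]) (use i2 in auto)
    also have "\<dots> = 2^n * (\<integral>x. (?f x - ?h x)\<^sup>2 \<partial>M) + (1/2)^n * measure M (space M)"
      using i2 by (simp add: mult.commute)
    also have "\<dots> \<le> 2^n * (2 * (1/4)^n / \<kappa>) + (1/2)^n * measure M (space M)"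
      using sq by (intro add_right_mono mult_left_mono) auto
    also have "2^n * (2 * (1/4)^n / \<kappa>) = (1/2)^n * (2 / \<kappa>)"
      by (simp flip: power_mult_distrib mult.assoc)
    finally have 1: "(\<integral>x. \<bar>?f x - ?h x\<bar> \<partial>M) \<le> (1/2)^n * (2 / \<kappa>) + (1/2)^n * measure M (space M)" .
    have "(\<integral>x. \<bar>?h x - br (g n) x\<bar> \<partial>M) \<le> (\<integral>x. \<bar>?f x - br (g n) x\<bar> + \<bar>?f x - ?h x\<bar> \<partial>M)"
      by (intro integral_mono Bochner_Integration.integrable_add if1 if2 integrable_abs
            int_d[OF br_m[OF gD] br_m[OF gD] br_B br_B]) auto
    also have "\<dots> = (\<integral>x. \<bar>?f x - br (g n) x\<bar> \<partial>M) + (\<integral>x. \<bar>?f x - ?h x\<bar> \<partial>M)"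
      using if1 if2 by simp
    finally show ?thesis using 1 close[OF gD[of "Suc n"], of n] by (simp add: s_def)
  qed
  have sum1: "summable (\<lambda>n. (1/4::real)^n * c)" "summable (\<lambda>n. (1/2::real)^n * c)" for c
    by (auto intro!: summable_mult2 summable_geometric)
  have "AE x in M. summable (\<lambda>n. br (g (Suc n)) x - br (g n) x)"
    by (rule AE_summable_of_summable_L1[OF _ int_d[OF br_m[OF gD] br_m[OF gD] br_B br_B] step])
      (auto intro!: summable_add sum1)
  then have conv_f: "AE x in M. convergent (\<lambda>n. br (g n) x)"
  proof eventually_elim
    case (elim x)
    then have "convergent (\<lambda>n. br (g n) x - br (g 0) x)"
      by (simp add: summable_iff_convergent sum_lessThan_telescope[where f="\<lambda>n. br (g n) x"])
    then show ?case by (simp add: convergent_diff_const_right_iff)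
  qed
  define f where "f x = lim (\<lambda>n. br (g n) x)" for x
  \<comment> \<open>The limit is only controlled almost everywhere; clipping enforces the bound
    \<open>B\<close> at every point without changing it where the sequence converges.\<close>
  define f' where "f' x = clip B (f x)" for x
  have fm [measurable]: "f \<in> borel_measurable M" unfolding f_def by (rule borel_measurable_lim_metric) simp
  have f'm: "f' \<in> borel_measurable M" unfolding f'_def by measurable
  have lim_f: "AE x in M. (\<lambda>n. br (g n) x) \<longlonglongrightarrow> f' x"
    using conv_f
  proof eventually_elim
    case (elim x)
    then have l: "(\<lambda>n. br (g n) x) \<longlonglongrightarrow> f x" by (simp add: f_def convergent_LIMSEQ_iff)
    have "\<bar>f x\<bar> \<le> B" using tendsto_rabs[OF l] by (rule LIMSEQ_le_const2) (auto simp: br_B)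
    then have "f' x = f x" by (auto simp: f'_def clip_def)
    with l show ?case by simp
  qed
  show thesis
  proof (rule that[OF f'm])
    show "\<bar>f' x\<bar> \<le> B" for x using B abs_clip_le by (simp add: f'_def)
    fix h u assume hD: "(h, u) \<in> D"
    note f [measurable] = br_m[OF mixD[OF hD]] and [measurable] = gm[OF hD]
    \<comment> \<open>The perturbed best responses differ from \<open>br (g n)\<close> by summable
      \<open>L\<^sup>1\<close> amounts, so they converge almost everywhere to the same limit,
      whatever \<open>h\<close> is.\<close>
    have "AE x in M. summable (\<lambda>n. br (mix n h) x - br (g n) x)"
      using close[OF hD] by (intro AE_summable_of_summable_L1[where b="\<lambda>n. s n * (R / \<kappa>)"]
          int_d[OF br_m[OF mixD[OF hD]] br_m[OF gD] br_B br_B]) (auto simp: s_def intro: sum1)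
    with lim_f have lim_mix: "AE x in M. (\<lambda>n. br (mix n h) x) \<longlonglongrightarrow> f' x"
    proof eventually_elim
      case (elim x)
      from tendsto_add[OF elim(1) summable_LIMSEQ_zero[OF elim(2)]] show ?case by simp
    qed
    have "(\<lambda>n. \<integral>x. h x * br (mix n h) x \<partial>M) \<longlonglongrightarrow> (\<integral>x. h x * f' x \<partial>M)"
    proof (rule integral_dominated_convergence)
      show "integrable M (\<lambda>x. B * \<bar>h x\<bar>)" using int[OF hD] by auto
      show "AE x in M. (\<lambda>n. h x * br (mix n h) x) \<longlonglongrightarrow> h x * f' x"
        using lim_mix by eventually_elim (intro tendsto_intros)
      show "AE x in M. norm (h x * br (mix n h) x) \<le> B * \<bar>h x\<bar>" for n
        using mult_left_mono[OF br_B abs_ge_zero] by (simp add: abs_mult mult.commute[of B])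
    qed (use f'm in measurable)
    then have "(\<lambda>n. u - (\<integral>x. h x * br (mix n h) x \<partial>M)) \<longlonglongrightarrow> u - (\<integral>x. h x * f' x \<partial>M)"
      by (intro tendsto_intros)
    moreover have "(\<lambda>n. S + (1/4)^n) \<longlonglongrightarrow> S + 0"
      by (intro tendsto_intros LIMSEQ_realpow_zero) auto
    moreover have "u - (\<integral>x. h x * br (mix n h) x \<partial>M) \<le> S + (1/4)^n" for n
    proof -
      \<comment> \<open>The quadratic part of the payoff is nonnegative and is dropped, leaving the
        bilinear game in which the limit is taken.\<close>
      have "0 \<le> \<kappa> * (\<integral>x. (br (mix n h) x)\<^sup>2 \<partial>M)" using \<kappa> by simp
      then show ?thesis using near[OF hD, of n] by (simp add: F_def)
    qed
    ultimately have "u - (\<integral>x. h x * f' x \<partial>M) \<le> S + 0"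
      by (intro LIMSEQ_le[where X="\<lambda>n. u - (\<integral>x. h x * br (mix n h) x \<partial>M)"]) auto
    then show "u \<le> w + \<delta> + (\<integral>x. h x * f' x \<partial>M)" using S_le by simp
  qed
qed

section \<open>Approximating a linear functional by expectations\<close>

lemma measure_mixture:
  assumes "prob_space P0" "prob_space P1" "sets P1 = sets P0" "0 \<le> c" "c \<le> 1"
  shows "measure (mixture c P0 P1) A = c * measure P0 A + (1 - c) * measure P1 A"
proof -
  interpret P0: prob_space P0 by fact
  interpret P1: prob_space P1 by fact
  have "emeasure (mixture c P0 P1) A = ennreal (c * measure P0 A + (1 - c) * measure P1 A)"
    using assms(3-5) unfolding emeasure_mixture[OF assms(3)] P0.emeasure_eq_measure P1.emeasure_eq_measure
    by (simp add: ennreal_mult ennreal_plus)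
  then show ?thesis
    using assms(4,5) by (intro measure_eq_emeasure_eq_ennreal) auto
qed

lemma tv_dist_upper:
  assumes "prob_space P0" "prob_space P1" "A \<in> sets P0"
  shows "\<bar>measure P0 A - measure P1 A\<bar> \<le> tv_dist P0 P1"
  unfolding tv_dist_def
proof (rule cSUP_upper[OF assms(3)], rule bdd_aboveI2)
  fix A
  show "\<bar>measure P0 A - measure P1 A\<bar> \<le> 1"
    using prob_space.prob_le_1[OF assms(1), of A] prob_space.prob_le_1[OF assms(2), of A]
      measure_nonneg[of P0 A] measure_nonneg[of P1 A] by linarith
qed

lemma tv_dist_least:
  assumes "\<And>A. A \<in> sets P0 \<Longrightarrow> \<bar>measure P0 A - measure P1 A\<bar> \<le> b"
  shows "tv_dist P0 P1 \<le> b"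
  unfolding tv_dist_def using sets.top by (intro cSUP_least assms) auto

lemma tv_dist_mixture_le:
  assumes "prob_space P0" "prob_space P1" "sets P1 = sets P0" "0 \<le> c" "c \<le> 1"
  shows "tv_dist (mixture c P0 P1) P1 \<le> c * tv_dist P0 P1"
proof (rule tv_dist_least)
  fix A assume "A \<in> sets (mixture c P0 P1)"
  then have A: "A \<in> sets P0" by simp
  have "measure (mixture c P0 P1) A - measure P1 A = c * (measure P0 A - measure P1 A)"
    by (simp add: measure_mixture[OF assms] algebra_simps)
  then show "\<bar>measure (mixture c P0 P1) A - measure P1 A\<bar> \<le> c * tv_dist P0 P1"
    using assms(4) tv_dist_upper[OF assms(1,2) A] by (simp add: abs_mult mult_left_mono)
qed

text \<open>Equal total mass makes the differences on \<open>A\<close> and on its complement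
  opposite, so twice the difference on \<open>A\<close> is split over two disjoint sets. The
  resulting factor 2 is the one in the bound
  \<open>omega_TV \<P> \<theta> \<epsilon> / (2 * \<epsilon>)\<close> below.\<close>

lemma tv_dist_density_le:
  assumes "finite_measure \<nu>" "integrable \<nu> p" "integrable \<nu> q" "\<And>x. 0 \<le> p x" "\<And>x. 0 \<le> q x"
    and P: "P = density \<nu> (\<lambda>x. ennreal (p x))" and Q: "Q = density \<nu> (\<lambda>x. ennreal (q x))"
    and "prob_space P" "prob_space Q"
  shows "2 * tv_dist P Q \<le> (\<integral>x. \<bar>p x - q x\<bar> \<partial>\<nu>)"
proof -
  interpret P: prob_space P by fact
  interpret Q: prob_space Q by fact
  have [measurable]: "p \<in> borel_measurable \<nu>" "q \<in> borel_measurable \<nu>" using assms by auto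
  have sP: "sets P = sets \<nu>" "sets Q = sets \<nu>" "space P = space \<nu>" "space Q = space \<nu>" by (auto simp: P Q)
  have m: "measure P A - measure Q A = (\<integral>x. indicator A x * (p x - q x) \<partial>\<nu>)" if "A \<in> sets \<nu>" for A
  proof -
    have "(\<integral>x. indicator A x \<partial>P) = (\<integral>x. p x *\<^sub>R (indicator A x :: real) \<partial>\<nu>)"
      unfolding P by (rule integral_density) (use that assms(4) in auto)
    moreover have "(\<integral>x. indicator A x \<partial>Q) = (\<integral>x. q x *\<^sub>R (indicator A x :: real) \<partial>\<nu>)"
      unfolding Q by (rule integral_density) (use that assms(5) in auto)
    ultimately have "measure P A = (\<integral>x. indicator A x * p x \<partial>\<nu>)" "measure Q A = (\<integral>x. indicator A x * q x \<partial>\<nu>)"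
      using that sP sets.sets_into_space[OF that] by (auto simp: mult.commute Int_absorb2)
    moreover have "integrable \<nu> (\<lambda>x. indicator A x * p x)" "integrable \<nu> (\<lambda>x. indicator A x * q x)"
      using that assms(2,3) by (auto intro: integrable_real_mult_indicator simp: mult.commute)
    ultimately show ?thesis by (simp add: right_diff_distrib)
  qed
  have int: "integrable \<nu> (\<lambda>x. indicator A x * (p x - q x))" if "A \<in> sets \<nu>" for A
    using integrable_real_mult_indicator[OF that, of "\<lambda>x. p x - q x"] assms(2,3)
    by (simp add: mult.commute)
  have "2 * \<bar>measure P A - measure Q A\<bar> \<le> (\<integral>x. \<bar>p x - q x\<bar> \<partial>\<nu>)" if "A \<in> sets P" for A
  proof -
    have A [measurable]: "A \<in> sets \<nu>" and cA [measurable]: "space \<nu> - A \<in> sets \<nu>" using that sP by auto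
    have "measure P (space \<nu> - A) - measure Q (space \<nu> - A) = - (measure P A - measure Q A)"
      using P.prob_compl[of A] Q.prob_compl[of A] that sP by simp
    then have "2 * \<bar>measure P A - measure Q A\<bar>
        = \<bar>\<integral>x. indicator A x * (p x - q x) \<partial>\<nu>\<bar> + \<bar>\<integral>x. indicator (space \<nu> - A) x * (p x - q x) \<partial>\<nu>\<bar>"
      unfolding m[OF A, symmetric] m[OF cA, symmetric] by simp
    also have "\<dots> \<le> (\<integral>x. \<bar>indicator A x * (p x - q x)\<bar> \<partial>\<nu>) + (\<integral>x. \<bar>indicator (space \<nu> - A) x * (p x - q x)\<bar> \<partial>\<nu>)"
      by (intro add_mono integral_abs_bound)
    also have "\<dots> = (\<integral>x. \<bar>indicator A x * (p x - q x)\<bar> + \<bar>indicator (space \<nu> - A) x * (p x - q x)\<bar> \<partial>\<nu>)"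
      by (intro Bochner_Integration.integral_add[symmetric] integrable_abs int A cA)
    also have "\<dots> = (\<integral>x. \<bar>p x - q x\<bar> \<partial>\<nu>)"
      by (intro Bochner_Integration.integral_cong) (auto simp: indicator_def)
    finally show ?thesis .
  qed
  then have "tv_dist P Q \<le> (\<integral>x. \<bar>p x - q x\<bar> \<partial>\<nu>) / 2" by (intro tv_dist_least) (auto simp: field_simps)
  then show ?thesis by simp
qed

section \<open>The modulus of continuity\<close>

lemma omega_TV_upper:
  assumes "bdd_above ((\<lambda>P. \<bar>\<theta> P\<bar>) ` \<P>)" "P0 \<in> \<P>" "P1 \<in> \<P>" "tv_dist P0 P1 \<le> \<epsilon>"
  shows "\<bar>\<theta> P0 - \<theta> P1\<bar> \<le> omega_TV \<P> \<theta> \<epsilon>"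
  unfolding omega_TV_def
proof (rule cSup_upper)
  obtain b where b: "\<And>P. P \<in> \<P> \<Longrightarrow> \<bar>\<theta> P\<bar> \<le> b" using assms(1) by (auto simp: bdd_above_def)
  have "\<bar>\<theta> Q0 - \<theta> Q1\<bar> \<le> 2 * b" if "Q0 \<in> \<P>" "Q1 \<in> \<P>" for Q0 Q1
    using b[OF that(1)] b[OF that(2)] by linarith
  then show "bdd_above {\<bar>\<theta> P0 - \<theta> P1\<bar> |P0 P1. P0 \<in> \<P> \<and> P1 \<in> \<P> \<and> tv_dist P0 P1 \<le> \<epsilon>}"
    by (intro bdd_aboveI) auto
qed (use assms in blast)

text \<open>By linearity \<^term>\<open>\<lambda>\<epsilon>. omega_TV \<P> \<theta> \<epsilon> / \<epsilon>\<close> is non-increasing.\<close>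

lemma linear_functional_diff_le:
  assumes \<P>: "\<P> \<subseteq> space (prob_algebra M)" and conv: "convex_measures \<P>"
    and lin: "linear_functional_on \<P> \<theta>" and bdd: "bdd_above ((\<lambda>P. \<bar>\<theta> P\<bar>) ` \<P>)"
    and P: "P0 \<in> \<P>" "P1 \<in> \<P>" and \<epsilon>: "0 < \<epsilon>"
  shows "\<bar>\<theta> P0 - \<theta> P1\<bar> \<le> omega_TV \<P> \<theta> \<epsilon> * max 1 (tv_dist P0 P1 / \<epsilon>)"
proof (cases "tv_dist P0 P1 \<le> \<epsilon>")
  case True
  then have "max 1 (tv_dist P0 P1 / \<epsilon>) = 1" using \<epsilon> by (simp add: max_def)
  then show ?thesis using omega_TV_upper[OF bdd P True] by simp
next
  case False
  \<comment> \<open>Moving \<open>P0\<close> towards \<open>P1\<close> with this weight brings the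
    distance down to \<epsilon>, while linearity shrinks the difference of \<theta> by the same
    factor.\<close>
  define c where "c = \<epsilon> / tv_dist P0 P1"
  have c: "0 < c" "c \<le> 1" using False \<epsilon> by (auto simp: c_def)
  have pr: "prob_space P0" "prob_space P1" "sets P1 = sets P0"
    using P \<P> by (auto simp: space_prob_algebra)
  have Q: "mixture c P0 P1 \<in> \<P>" using conv P c by (auto simp: convex_measures_def)
  have "tv_dist (mixture c P0 P1) P1 \<le> c * tv_dist P0 P1" using tv_dist_mixture_le[OF pr] c by simp
  also have "\<dots> = \<epsilon>" using False \<epsilon> by (simp add: c_def)
  finally have "\<bar>\<theta> (mixture c P0 P1) - \<theta> P1\<bar> \<le> omega_TV \<P> \<theta> \<epsilon>" by (rule omega_TV_upper[OF bdd Q P(2)])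
  moreover have "\<theta> (mixture c P0 P1) = c * \<theta> P0 + (1 - c) * \<theta> P1"
    using lin P c by (auto simp: linear_functional_on_def)
  then have "\<theta> (mixture c P0 P1) - \<theta> P1 = c * (\<theta> P0 - \<theta> P1)"
    by (simp add: algebra_simps)
  ultimately have "c * \<bar>\<theta> P0 - \<theta> P1\<bar> \<le> omega_TV \<P> \<theta> \<epsilon>" using c by (simp add: abs_mult)
  then have "\<bar>\<theta> P0 - \<theta> P1\<bar> \<le> omega_TV \<P> \<theta> \<epsilon> * (1 / c)" using c by (simp add: field_simps)
  also have "1 / c = max 1 (tv_dist P0 P1 / \<epsilon>)" using False \<epsilon> by (simp add: c_def max_def)
  finally show ?thesis .
qed

section \<open>Domination by a finite measure, densities and the approximation of the
  functional\<close>

text \<open>Weighting the dominating measure with a strictly positive integrable function makes it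
  finite without creating null sets. Finiteness is what \<open>bounded_separation\<close> asks
  for.\<close>

lemma dominated_measures_finiteE:
  assumes "dominated_measures M \<P>"
  obtains \<nu> where "finite_measure \<nu>" "sets \<nu> = sets M" "\<And>P. P \<in> \<P> \<Longrightarrow> absolutely_continuous \<nu> P"
proof -
  obtain \<mu> where \<mu>: "sigma_finite_measure \<mu>" "sets \<mu> = sets M" "\<And>P. P \<in> \<P> \<Longrightarrow> absolutely_continuous \<mu> P"
    using assms by (auto simp: dominated_measures_def)
  interpret sigma_finite_measure \<mu> by fact
  obtain h :: "_ \<Rightarrow> real" where h: "h \<in> borel_measurable \<mu>" "\<And>x. 0 < h x" "integrable \<mu> h"
    using obtain_positive_integrable_function by metis
  show thesis
  proof
    show "finite_measure (density \<mu> (\<lambda>x. ennreal (h x)))"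
    proof (rule finite_measureI)
      have "emeasure (density \<mu> (\<lambda>x. ennreal (h x))) (space \<mu>) = (\<integral>\<^sup>+x. ennreal (h x) \<partial>\<mu>)"
        using h(1) by (subst emeasure_density) (auto intro!: nn_integral_cong)
      also have "\<dots> = ennreal (\<integral>x. h x \<partial>\<mu>)"
        using h by (intro nn_integral_eq_integral) (auto intro: less_imp_le)
      finally show "emeasure (density \<mu> (\<lambda>x. ennreal (h x))) (space (density \<mu> (\<lambda>x. ennreal (h x)))) \<noteq> \<infinity>"
        by simp
    qed
    show "absolutely_continuous (density \<mu> (\<lambda>x. ennreal (h x))) P" if "P \<in> \<P>" for P
    proof -
      have "N \<in> null_sets \<mu>" if "N \<in> null_sets (density \<mu> (\<lambda>x. ennreal (h x)))" for N
      proof -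
        have N: "N \<in> sets \<mu>" "AE x in \<mu>. x \<in> N \<longrightarrow> ennreal (h x) = 0"
          using that h(1) by (auto simp: null_sets_density_iff)
        from N(2) have "AE x in \<mu>. x \<notin> N"
          by eventually_elim (metis ennreal_eq_0_iff h(2) not_le)
        then show ?thesis using N(1) by (simp add: AE_iff_null_sets)
      qed
      then show ?thesis using \<mu>(3)[OF that] by (auto simp: absolutely_continuous_def)
    qed
  qed (use \<mu> in auto)
qed

lemma prob_density_real:
  assumes "finite_measure \<nu>" "absolutely_continuous \<nu> P" "sets P = sets \<nu>" "prob_space P"
  obtains p where "p \<in> borel_measurable \<nu>" "\<And>x. 0 \<le> p x" "P = density \<nu> (\<lambda>x. ennreal (p x))"
proof -
  interpret finite_measure \<nu> by fact
  interpret P: prob_space P by fact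
  obtain D where D: "D \<in> borel_measurable \<nu>" "AE x in \<nu>. RN_deriv \<nu> P x = ennreal (D x)" "\<And>x. 0 \<le> D x"
    using real_RN_deriv[OF P.finite_measure_axioms assms(2,3)] by metis
  have "P = density \<nu> (RN_deriv \<nu> P)" using density_RN_deriv[OF assms(2,3)] by simp
  also have "\<dots> = density \<nu> (\<lambda>x. ennreal (D x))" using D by (intro density_cong) auto
  finally show thesis using that D by blast
qed

lemma mixture_density:
  assumes [measurable]: "p \<in> borel_measurable \<nu>" "q \<in> borel_measurable \<nu>"
    and "\<And>x. 0 \<le> p x" "\<And>x. 0 \<le> q x" "0 \<le> c" "c \<le> 1"
  shows "mixture c (density \<nu> (\<lambda>x. ennreal (p x))) (density \<nu> (\<lambda>x. ennreal (q x)))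
    = density \<nu> (\<lambda>x. ennreal (c * p x + (1 - c) * q x))" (is "mixture c ?P ?Q = ?R")
proof (rule measure_eqI)
  fix A assume "A \<in> sets (mixture c ?P ?Q)"
  then have [measurable]: "A \<in> sets \<nu>" by simp
  have "emeasure (mixture c ?P ?Q) A = ennreal c * (\<integral>\<^sup>+x. ennreal (p x) * indicator A x \<partial>\<nu>)
      + ennreal (1 - c) * (\<integral>\<^sup>+x. ennreal (q x) * indicator A x \<partial>\<nu>)"
    by (simp add: emeasure_mixture emeasure_density)
  also have "\<dots> = (\<integral>\<^sup>+x. ennreal c * (ennreal (p x) * indicator A x)
      + ennreal (1 - c) * (ennreal (q x) * indicator A x) \<partial>\<nu>)"
    by (simp add: nn_integral_add nn_integral_cmult)
  also have "\<dots> = (\<integral>\<^sup>+x. ennreal (c * p x + (1 - c) * q x) * indicator A x \<partial>\<nu>)"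
    using assms(3-6) by (intro nn_integral_cong) (auto simp: indicator_def ennreal_plus ennreal_mult)
  also have "\<dots> = emeasure ?R A" by (simp add: emeasure_density)
  finally show "emeasure (mixture c ?P ?Q) A = emeasure ?R A" .
qed simp

text \<open>\<open>bounded_separation\<close> is applied to differences of densities paired with the
  corresponding differences of \<theta>. The residual
  \<open>\<theta> P - (\<integral>x. f x \<partial>P)\<close> then oscillates by at most
  \<open>omega_TV \<P> \<theta> \<epsilon> + \<delta>\<close> over the family, and centring it
  halves this.\<close>

lemma bounded_expectation_approximation:
  assumes ne: "\<P> \<noteq> {}" and \<P>: "\<P> \<subseteq> space (prob_algebra M)" and conv: "convex_measures \<P>"
    and dom: "dominated_measures M \<P>"
    and lin: "linear_functional_on \<P> \<theta>" and bdd: "bdd_above ((\<lambda>P. \<bar>\<theta> P\<bar>) ` \<P>)"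
    and \<epsilon>: "0 < \<epsilon>" and pos: "0 < omega_TV \<P> \<theta> \<epsilon>" and \<delta>: "0 < \<delta>"
  obtains f c where "f \<in> borel_measurable M" "\<And>x. \<bar>f x\<bar> \<le> omega_TV \<P> \<theta> \<epsilon> / (2 * \<epsilon>)"
    "\<And>P. P \<in> \<P> \<Longrightarrow> \<bar>\<theta> P - (\<integral>x. f x \<partial>P) - c\<bar> \<le> (omega_TV \<P> \<theta> \<epsilon> + \<delta>) / 2"
proof -
  define w where "w = omega_TV \<P> \<theta> \<epsilon>"
  define B where "B = w / (2 * \<epsilon>)"
  have B: "0 < B" using pos \<epsilon> by (simp add: B_def w_def)
  obtain \<nu> where \<nu>: "finite_measure \<nu>" "sets \<nu> = sets M" and ac: "\<And>P. P \<in> \<P> \<Longrightarrow> absolutely_continuous \<nu> P"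
    using dominated_measures_finiteE[OF dom] by metis
  interpret \<nu>: finite_measure \<nu> by fact
  have pr: "prob_space P" "sets P = sets \<nu>" if "P \<in> \<P>" for P
    using that \<P> \<nu>(2) by (auto simp: space_prob_algebra)
  define dens where "dens P p \<longleftrightarrow> P \<in> \<P> \<and> p \<in> borel_measurable \<nu> \<and> (\<forall>x. 0 \<le> p x) \<and>
    P = density \<nu> (\<lambda>x. ennreal (p x))" for P p
  have dens_int: "integrable \<nu> p" "(\<integral>x. p x \<partial>\<nu>) = 1" if "dens P p" for P p
  proof -
    have p: "p \<in> borel_measurable \<nu>" "\<And>x. 0 \<le> p x" "P = density \<nu> (\<lambda>x. ennreal (p x))" "prob_space P"
      using that pr by (auto simp: dens_def)
    have "(\<integral>\<^sup>+x. ennreal (p x) \<partial>\<nu>) = emeasure P (space P)"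
      using p(1,3) by (auto simp: emeasure_density intro!: nn_integral_cong)
    then have "(\<integral>\<^sup>+x. ennreal (p x) \<partial>\<nu>) = ennreal 1"
      using prob_space.emeasure_space_1[OF p(4)] by simp
    then have "has_bochner_integral \<nu> p 1"
      using p(1,2) by (intro has_bochner_integral_nn_integral) auto
    then show "integrable \<nu> p" "(\<integral>x. p x \<partial>\<nu>) = 1" by (auto simp: has_bochner_integral_iff)
  qed
  have dens_mix: "dens (mixture (1 - s) P Q) (\<lambda>x. (1 - s) * p x + s * q x)"
    if "dens P p" "dens Q q" "0 \<le> s" "s \<le> 1" for P Q p q s
  proof -
    have "mixture (1 - s) P Q \<in> \<P>" using that conv by (auto simp: dens_def convex_measures_def)
    moreover have "mixture (1 - s) P Q = density \<nu> (\<lambda>x. ennreal ((1 - s) * p x + s * q x))"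
      using that mixture_density[of p \<nu> q "1 - s"] by (simp add: dens_def del: ennreal_plus)
    moreover have "(\<lambda>x. (1 - s) * p x + s * q x) \<in> borel_measurable \<nu>"
      using that by (auto simp: dens_def)
    ultimately show ?thesis using that by (simp add: dens_def del: ennreal_plus)
  qed
  have theta_mix: "\<theta> (mixture (1 - s) P Q) = (1 - s) * \<theta> P + s * \<theta> Q"
    if "P \<in> \<P>" "Q \<in> \<P>" "0 \<le> s" "s \<le> 1" for P Q s
    using lin that by (auto simp: linear_functional_on_def)
  \<comment> \<open>Convex because both members of a pair can be mixed with the same weights, under
    which densities and \<theta> are affine. Each density difference has \<open>L\<^sup>1\<close>
    norm at most 2, whence the value of \<open>R\<close>.\<close>
  define D where "D = {((\<lambda>x. p x - q x), \<theta> P - \<theta> Q) | P p Q q. dens P p \<and> dens Q q}"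
  have DI: "((\<lambda>x. p x - q x), \<theta> P - \<theta> Q) \<in> D" if "dens P p" "dens Q q" for P p Q q
    using that by (auto simp: D_def)
  have ex: "\<exists>p. dens P p" if "P \<in> \<P>" for P
    using prob_density_real[OF \<nu>(1) ac[OF that] pr(2)[OF that] pr(1)[OF that]] that
    by (metis dens_def)
  obtain f where f: "f \<in> borel_measurable \<nu>" "\<And>x. \<bar>f x\<bar> \<le> B"
    "\<And>g t. (g, t) \<in> D \<Longrightarrow> t \<le> w + \<delta> + (\<integral>x. g x * f x \<partial>\<nu>)"
  proof (rule \<nu>.bounded_separation[of D 2 w B \<delta>])
    show "D \<noteq> {}" using ne ex by (fastforce simp: D_def)
    show "integrable \<nu> g" if "(g, t) \<in> D" for g t
      using that dens_int by (auto simp: D_def)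
    show "(\<integral>x. \<bar>g x\<bar> \<partial>\<nu>) \<le> 2" if gt: "(g, t) \<in> D" for g t
    proof -
      obtain P p Q q where d: "dens P p" "dens Q q" and g: "g = (\<lambda>x. p x - q x)"
        using gt by (auto simp: D_def)
      have "(\<integral>x. \<bar>g x\<bar> \<partial>\<nu>) \<le> (\<integral>x. p x + q x \<partial>\<nu>)"
        using d dens_int[OF d(1)] dens_int[OF d(2)] by (intro integral_mono) (auto simp: g dens_def abs_le_iff)
      then show ?thesis using dens_int[OF d(1)] dens_int[OF d(2)] by simp
    qed
    show "((\<lambda>x. (1 - s) * g x + s * h x), (1 - s) * t + s * u) \<in> D"
      if gh: "(g, t) \<in> D" "(h, u) \<in> D" and s: "0 \<le> s" "s \<le> 1" for g t h u s
    proof -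
      obtain P p Q q where d: "dens P p" "dens Q q" and g: "g = (\<lambda>x. p x - q x)" "t = \<theta> P - \<theta> Q"
        using gh by (auto simp: D_def)
      obtain P' p' Q' q' where d': "dens P' p'" "dens Q' q'" and h: "h = (\<lambda>x. p' x - q' x)" "u = \<theta> P' - \<theta> Q'"
        using gh by (auto simp: D_def)
      have mem: "P \<in> \<P>" "Q \<in> \<P>" "P' \<in> \<P>" "Q' \<in> \<P>" using d d' by (auto simp: dens_def)
      have "(1 - s) * t + s * u = \<theta> (mixture (1 - s) P P') - \<theta> (mixture (1 - s) Q Q')"
        using theta_mix mem s by (simp add: g h algebra_simps)
      moreover have "(\<lambda>x. (1 - s) * g x + s * h x)
          = (\<lambda>x. ((1 - s) * p x + s * p' x) - ((1 - s) * q x + s * q' x))"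
        by (simp add: g h algebra_simps)
      ultimately show ?thesis
        using DI[OF dens_mix[OF d(1) d'(1) s] dens_mix[OF d(2) d'(2) s]] by simp
    qed
    show "t \<le> w + B * (\<integral>x. \<bar>g x\<bar> \<partial>\<nu>)" if gt: "(g, t) \<in> D" for g t
    proof -
      obtain P p Q q where d: "dens P p" "dens Q q" and g: "g = (\<lambda>x. p x - q x)" "t = \<theta> P - \<theta> Q"
        using gt by (auto simp: D_def)
      have mem: "P \<in> \<P>" "Q \<in> \<P>" using d by (auto simp: dens_def)
      have "2 * tv_dist P Q \<le> (\<integral>x. \<bar>g x\<bar> \<partial>\<nu>)"
        unfolding g using d dens_int[OF d(1)] dens_int[OF d(2)] pr[OF mem(1)] pr[OF mem(2)]
        by (intro tv_dist_density_le[OF \<nu>(1)]) (auto simp: dens_def)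
      then have tv: "tv_dist P Q \<le> (\<integral>x. \<bar>g x\<bar> \<partial>\<nu>) / 2" by simp
      \<comment> \<open>Replacing the maximum by the sum \<open>1 + y\<close> and the total
        variation distance by half the \<open>L\<^sup>1\<close> norm gives precisely the slope
        \<open>B = w / (2 * \<epsilon>)\<close>.\<close>
      have "t \<le> w * max 1 (tv_dist P Q / \<epsilon>)"
        using linear_functional_diff_le[OF \<P> conv lin bdd mem \<epsilon>] by (simp add: g w_def)
      also have "\<dots> \<le> w * (1 + (\<integral>x. \<bar>g x\<bar> \<partial>\<nu>) / 2 / \<epsilon>)"
      proof (rule mult_left_mono)
        have "tv_dist P Q / \<epsilon> \<le> (\<integral>x. \<bar>g x\<bar> \<partial>\<nu>) / 2 / \<epsilon>" using tv \<epsilon> by (intro divide_right_mono) auto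
        moreover have "0 \<le> (\<integral>x. \<bar>g x\<bar> \<partial>\<nu>) / 2 / \<epsilon>" using \<epsilon> by simp
        ultimately show "max 1 (tv_dist P Q / \<epsilon>) \<le> 1 + (\<integral>x. \<bar>g x\<bar> \<partial>\<nu>) / 2 / \<epsilon>" by simp
      qed (use pos in \<open>simp add: w_def\<close>)
      also have "\<dots> = w + B * (\<integral>x. \<bar>g x\<bar> \<partial>\<nu>)" by (simp add: B_def algebra_simps)
      finally show ?thesis .
    qed
  qed (use B \<delta> in auto)
  have fM: "f \<in> borel_measurable M" using f(1) \<nu>(2) by (simp cong: measurable_cong_sets)
  define r where "r P = \<theta> P - (\<integral>x. f x \<partial>P)" for P
  have r: "r P - r Q \<le> w + \<delta>" if mem: "P \<in> \<P>" "Q \<in> \<P>" for P Q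
  proof -
    obtain p q where d: "dens P p" "dens Q q" using ex mem by blast
    have e: "(\<integral>x. f x \<partial>R) = (\<integral>x. p x * f x \<partial>\<nu>)" if "dens R p" for R p
      using that f(1) by (auto simp: dens_def integral_density)
    have "(\<integral>x. (p x - q x) * f x \<partial>\<nu>) = (\<integral>x. f x \<partial>P) - (\<integral>x. f x \<partial>Q)"
      unfolding e[OF d(1)] e[OF d(2)] left_diff_distrib
      using integrable_mult_bounded[OF dens_int(1)[OF d(1)] f(1,2)]
        integrable_mult_bounded[OF dens_int(1)[OF d(2)] f(1,2)] by simp
    moreover have "\<theta> P - \<theta> Q \<le> w + \<delta> + (\<integral>x. (p x - q x) * f x \<partial>\<nu>)"
      by (rule f(3)) (rule DI[OF d])
    ultimately show ?thesis by (simp add: r_def)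
  qed
  obtain P\<^sub>0 where P0: "P\<^sub>0 \<in> \<P>" using ne by auto
  have ba: "bdd_above (r ` \<P>)"
  proof (rule bdd_aboveI2)
    show "r P \<le> r P\<^sub>0 + (w + \<delta>)" if "P \<in> \<P>" for P using r[OF that P0] by simp
  qed
  \<comment> \<open>All residuals lie within \<open>w + \<delta>\<close> below their supremum; this
    is the midpoint of that interval.\<close>
  define c where "c = (SUP P\<in>\<P>. r P) - (w + \<delta>) / 2"
  show thesis
  proof (rule that[OF fM])
    show "\<bar>f x\<bar> \<le> omega_TV \<P> \<theta> \<epsilon> / (2 * \<epsilon>)" for x using f(2) by (simp add: B_def w_def)
    fix P assume P: "P \<in> \<P>"
    have "r P \<le> (SUP P\<in>\<P>. r P)" using ba P by (rule cSUP_upper2) simp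
    moreover have "(SUP P\<in>\<P>. r P) \<le> r P + (w + \<delta>)"
    proof (rule cSUP_least[OF ne])
      show "r Q \<le> r P + (w + \<delta>)" if "Q \<in> \<P>" for Q using r[OF that P] by simp
    qed
    ultimately have "\<bar>r P - c\<bar> \<le> (w + \<delta>) / 2" unfolding c_def by (simp add: abs_le_iff field_simps)
    then show "\<bar>\<theta> P - (\<integral>x. f x \<partial>P) - c\<bar> \<le> (omega_TV \<P> \<theta> \<epsilon> + \<delta>) / 2" by (simp add: r_def w_def)
  qed
qed

section \<open>Non-interactive private channels\<close>

lemma emeasure_PiM_box:
  assumes "finite I" "\<And>i. i \<in> I \<Longrightarrow> prob_space (M i)" "\<And>i. i \<in> I \<Longrightarrow> A i \<in> sets (M i)"
  shows "emeasure (PiM I M) (Pi\<^sub>E I A) = (\<Prod>i\<in>I. emeasure (M i) (A i))"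
proof -
  have "prod_emb I M I (Pi\<^sub>E I A) = Pi\<^sub>E I A"
    by (intro prod_emb_PiE_same_index sets.sets_into_space assms(3))
  then show ?thesis using emeasure_PiM_emb[of I M I A] assms by simp
qed

text \<open>Boxes form an intersection-stable generator of the product sigma-algebra, and the mass
  of a box is a finite product of measurable functions of single coordinates.\<close>

lemma measurable_PiM_kernel:
  assumes I: "finite I" and k: "k \<in> M \<rightarrow>\<^sub>M prob_algebra N"
  shows "(\<lambda>x. \<Pi>\<^sub>M i\<in>I. k (x i)) \<in> (\<Pi>\<^sub>M i\<in>I. M) \<rightarrow>\<^sub>M prob_algebra (\<Pi>\<^sub>M i\<in>I. N)"
proof (rule measurable_prob_algebra_generated[OF sets_PiM Int_stable_prod_algebra prod_algebra_sets_into_space])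
  have kx: "prob_space (k (x i))" "sets (k (x i)) = sets N"
    if "x \<in> space (\<Pi>\<^sub>M i\<in>I. M)" "i \<in> I" for x i
  proof -
    have "x i \<in> space M" using that by (auto simp: space_PiM)
    then show "prob_space (k (x i))" "sets (k (x i)) = sets N"
      using measurable_space[OF k] by (auto simp: space_prob_algebra)
  qed
  show "prob_space (\<Pi>\<^sub>M i\<in>I. k (x i))" if "x \<in> space (\<Pi>\<^sub>M i\<in>I. M)" for x
    by (rule prob_space_PiM) (rule kx[OF that])
  show "sets (\<Pi>\<^sub>M i\<in>I. k (x i)) = sets (\<Pi>\<^sub>M i\<in>I. N)" if "x \<in> space (\<Pi>\<^sub>M i\<in>I. M)" for x
    by (rule sets_PiM_cong) (auto simp: kx[OF that])
  fix A assume "A \<in> prod_algebra I (\<lambda>_. N)"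
  then obtain E where A: "A = Pi\<^sub>E I E" and E: "\<And>i. i \<in> I \<Longrightarrow> E i \<in> sets N"
    by (blast elim: prod_algebraE_all)
  have "emeasure (\<Pi>\<^sub>M i\<in>I. k (x i)) A = (\<Prod>i\<in>I. emeasure (k (x i)) (E i))"
    if "x \<in> space (\<Pi>\<^sub>M i\<in>I. M)" for x
    unfolding A by (rule emeasure_PiM_box[OF I]) (auto simp: kx[OF that] E)
  moreover have "(\<lambda>x. \<Prod>i\<in>I. emeasure (k (x i)) (E i)) \<in> borel_measurable (\<Pi>\<^sub>M i\<in>I. M)"
  proof (rule borel_measurable_prod_ennreal)
    fix i assume i: "i \<in> I"
    have "(\<lambda>y. emeasure (k y) (E i)) \<in> borel_measurable M"
      using measurable_prob_algebraD[OF k] E[OF i] by (rule measurable_emeasure_kernel)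
    then show "(\<lambda>x. emeasure (k (x i)) (E i)) \<in> borel_measurable (\<Pi>\<^sub>M i\<in>I. M)"
      using i by (rule measurable_compose[OF measurable_component_singleton, rotated])
  qed
  ultimately show "(\<lambda>x. emeasure (\<Pi>\<^sub>M i\<in>I. k (x i)) A) \<in> borel_measurable (\<Pi>\<^sub>M i\<in>I. M)"
    by (subst measurable_cong) auto
qed

text \<open>Product measures are determined on boxes, where the integral of a product of
  one-coordinate functions factorises. This makes the released views independent with common law
  \<open>P \<bind> k\<close>.\<close>

lemma bind_PiM_kernel:
  assumes I: "finite I" and P: "P \<in> space (prob_algebra M)" and k: "k \<in> M \<rightarrow>\<^sub>M prob_algebra N"
  shows "(\<Pi>\<^sub>M i\<in>I. P) \<bind> (\<lambda>x. \<Pi>\<^sub>M i\<in>I. k (x i)) = (\<Pi>\<^sub>M i\<in>I. P \<bind> k)" (is "?L = ?R")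
proof -
  have Pp: "prob_space P" and sP: "sets P = sets M" using P by (auto simp: space_prob_algebra)
  have kP [measurable]: "k \<in> P \<rightarrow>\<^sub>M prob_algebra N" using k sP by (simp cong: measurable_cong_sets)
  note kI = measurable_PiM_kernel[OF I kP]
  have PI: "(\<Pi>\<^sub>M i\<in>I. P) \<in> space (prob_algebra (\<Pi>\<^sub>M i\<in>I. P))"
    using prob_space_PiM[of I "\<lambda>_. P"] Pp by (auto simp: space_prob_algebra)
  have PP: "P \<in> space (prob_algebra P)" using Pp by (simp add: space_prob_algebra)
  have R: "prob_space (P \<bind> k)" "sets (P \<bind> k) = sets N"
    using prob_space_bind'[OF PP kP] sets_bind'[OF PP kP] by auto
  interpret R: product_sigma_finite "\<lambda>_::'a. P \<bind> k"
    by (rule product_sigma_finite.intro) (simp add: R(1) prob_space_imp_sigma_finite)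
  interpret P: product_sigma_finite "\<lambda>_::'a. P"
    by (rule product_sigma_finite.intro) (simp add: Pp prob_space_imp_sigma_finite)
  show ?thesis
  proof (rule R.PiM_eqI[OF I])
    have "sets ?L = sets (\<Pi>\<^sub>M i\<in>I. N)" by (rule sets_bind'[OF PI kI])
    also have "\<dots> = sets ?R" by (rule sets_PiM_cong) (auto simp: R(2))
    finally show "sets ?L = sets ?R" .
    fix A assume A: "\<And>i. i \<in> I \<Longrightarrow> A i \<in> sets (P \<bind> k)"
    then have A': "\<And>i. i \<in> I \<Longrightarrow> A i \<in> sets N" by (simp add: R(2))
    have "emeasure ?L (Pi\<^sub>E I A) = (\<integral>\<^sup>+x. emeasure (\<Pi>\<^sub>M i\<in>I. k (x i)) (Pi\<^sub>E I A) \<partial>(\<Pi>\<^sub>M i\<in>I. P))"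
      by (rule emeasure_bind_prob_algebra[OF PI kI]) (use I A' in \<open>auto intro!: sets_PiM_I_finite\<close>)
    also have "\<dots> = (\<integral>\<^sup>+x. (\<Prod>i\<in>I. emeasure (k (x i)) (A i)) \<partial>(\<Pi>\<^sub>M i\<in>I. P))"
    proof (rule nn_integral_cong)
      fix x assume "x \<in> space (\<Pi>\<^sub>M i\<in>I. P)"
      then have "k (x i) \<in> space (prob_algebra N)" if "i \<in> I" for i
        using that measurable_space[OF kP] by (auto simp: space_PiM)
      then show "emeasure (\<Pi>\<^sub>M i\<in>I. k (x i)) (Pi\<^sub>E I A) = (\<Prod>i\<in>I. emeasure (k (x i)) (A i))"
        using A' by (intro emeasure_PiM_box[OF I]) (auto simp: space_prob_algebra)
    qed
    also have "\<dots> = (\<Prod>i\<in>I. \<integral>\<^sup>+y. emeasure (k y) (A i) \<partial>P)"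
      by (rule P.product_nn_integral_prod[OF I, where f="\<lambda>i y. emeasure (k y) (A i)"])
        (use A' measurable_prob_algebraD[OF kP] in \<open>auto intro: measurable_emeasure_kernel\<close>)
    also have "\<dots> = (\<Prod>i\<in>I. emeasure (P \<bind> k) (A i))"
      using A' by (intro prod.cong) (simp_all add: emeasure_bind_prob_algebra[OF PP kP])
    finally show "emeasure ?L (Pi\<^sub>E I A) = (\<Prod>i\<in>I. emeasure (P \<bind> k) (A i))" .
  qed
qed

text \<open>When the kernels ignore earlier views, the iterated integral is Fubini's theorem read
  one coordinate at a time. The induction is over the number of remaining integrations, with the
  released prefix \<open>z\<close> and its length \<open>k\<close> general because the recursion
  extends them.\<close>

lemma iterated_kernel_product:
  fixes N :: "nat \<Rightarrow> (nat \<Rightarrow> real) measure"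
  assumes N: "\<And>i. prob_space (N i)" "\<And>i. sets (N i) = sets (view_space q)"
    and K: "\<And>i y. i < n \<Longrightarrow> K i (x i, y) = N i"
  shows "k + Suc m \<le> n \<Longrightarrow> A \<in> sets (views q (k + Suc m)) \<Longrightarrow> z \<in> space (views q k) \<Longrightarrow>
    iterated_kernel q K x A m k z =
      (\<integral>\<^sup>+w. indicator A (merge {..<k} {k..<k + Suc m} (z, w)) \<partial>(\<Pi>\<^sub>M i\<in>{k..<k + Suc m}. N i))"
proof (induction m arbitrary: k z)
  interpret N: product_sigma_finite N
    by (rule product_sigma_finite.intro) (simp add: N(1) prob_space_imp_sigma_finite)
  have sets_views: "sets (PiM J N) = sets (PiM J (\<lambda>_. view_space q))" for J
    by (rule sets_PiM_cong) (auto simp: N(2))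
  have spN: "space (N i) = space (view_space q)" for i using sets_eq_imp_space_eq[OF N(2)] .
  have meas: "(\<lambda>w. indicator A (merge {..<k} {k..<k + Suc m} (z, w)) :: ennreal)
      \<in> borel_measurable (PiM {k..<k + Suc m} N)"
    if A: "A \<in> sets (views q (k + Suc m))" and z: "z \<in> space (views q k)" for k m z
  proof -
    have "(\<lambda>w. merge {..<k} {k..<k + Suc m} (z, w)) \<in>
      PiM {k..<k + Suc m} (\<lambda>_. view_space q) \<rightarrow>\<^sub>M PiM ({..<k} \<union> {k..<k + Suc m}) (\<lambda>_. view_space q)"
      using z by (intro measurable_compose[OF measurable_Pair1' measurable_merge])
    moreover have "{..<k} \<union> {k..<k + Suc m} = {..<k + Suc m}" by auto
    ultimately have "(\<lambda>w. merge {..<k} {k..<k + Suc m} (z, w)) \<in> PiM {k..<k + Suc m} N \<rightarrow>\<^sub>M views q (k + Suc m)"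
      using sets_views by (simp cong: measurable_cong_sets)
    then show ?thesis using A by measurable
  qed
  have upd: "z(k := y) \<in> space (views q (Suc k))"
    if "z \<in> space (views q k)" "y \<in> space (view_space q)" for z k y
    using that by (auto simp: space_PiM PiE_iff extensional_def less_Suc_eq)
  {
    case (0 k z)
    have merge_upd: "merge {..<k} {k} (z, w) = z(k := w k)" for w
      using 0(3) by (auto simp: merge_def space_PiM PiE_iff extensional_def fun_eq_iff)
    have "(\<lambda>y. z(k := y)) \<in> view_space q \<rightarrow>\<^sub>M views q (Suc k)"
      using 0(3) unfolding lessThan_Suc
      by (intro measurable_fun_upd[where J="{..<k}"]) auto
    then have upd_m [measurable]: "(\<lambda>y. z(k := y)) \<in> N k \<rightarrow>\<^sub>M views q (Suc k)"
      using N(2) by (simp cong: measurable_cong_sets)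
    have A [measurable]: "A \<in> sets (views q (Suc k))" using 0(2) by simp
    have "(\<integral>\<^sup>+w. indicator A (merge {..<k} {k} (z, w)) \<partial>PiM {k} N) = (\<integral>\<^sup>+y. indicator A (z(k := y)) \<partial>N k)"
      unfolding merge_upd by (rule N.product_nn_integral_singleton) measurable
    also have "\<dots> = (\<integral>\<^sup>+y. indicator {y \<in> space (view_space q). z(k := y) \<in> A} y \<partial>N k)"
      by (intro nn_integral_cong) (auto simp: spN indicator_def)
    also have "\<dots> = emeasure (N k) {y \<in> space (view_space q). z(k := y) \<in> A}"
      by (rule nn_integral_indicator) (unfold spN[of k, symmetric], measurable)
    finally have eq: "(\<integral>\<^sup>+w. indicator A (merge {..<k} {k} (z, w)) \<partial>PiM {k} N)
      = emeasure (N k) {y \<in> space (view_space q). z(k := y) \<in> A}" .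
    have "K k (x k, z) = N k" using K[of k] 0(1) by simp
    moreover have "{k..<k + Suc 0} = {k}" by auto
    ultimately show ?case by (simp only: iterated_kernel.simps eq)
  next
    case (Suc m k z)
    let ?J = "{Suc k..<Suc k + Suc m}"
    have ins: "{k..<k + Suc (Suc m)} = insert k ?J" by auto
    have "iterated_kernel q K x A (Suc m) k z = (\<integral>\<^sup>+y. iterated_kernel q K x A m (Suc k) (z(k := y)) \<partial>N k)"
      using K[of k] Suc.prems(1) by simp
    also have "\<dots> = (\<integral>\<^sup>+y. \<integral>\<^sup>+w. indicator A (merge {..<Suc k} ?J (z(k := y), w)) \<partial>PiM ?J N \<partial>N k)"
    proof (rule nn_integral_cong)
      fix y assume "y \<in> space (N k)"
      then have "z(k := y) \<in> space (views q (Suc k))" using upd[OF Suc.prems(3)] by (simp only: spN)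
      moreover have "Suc k + Suc m \<le> n" "A \<in> sets (views q (Suc k + Suc m))"
        using Suc.prems(1,2) by simp_all
      ultimately show "iterated_kernel q K x A m (Suc k) (z(k := y))
        = (\<integral>\<^sup>+w. indicator A (merge {..<Suc k} ?J (z(k := y), w)) \<partial>PiM ?J N)"
        by (intro Suc.IH)
    qed
    \<comment> \<open>Coordinate \<open>k\<close> is handed over from the fixed prefix to the
      integrated tail; the merged tuple is unchanged, and one more factor can be absorbed into the
      product measure.\<close>
    also have "\<dots> = (\<integral>\<^sup>+y. \<integral>\<^sup>+w. indicator A (merge {..<k} {k..<k + Suc (Suc m)} (z, w(k := y))) \<partial>PiM ?J N \<partial>N k)"
    proof -
      have "merge {..<Suc k} ?J (z(k := y), w) = merge {..<k} {k..<k + Suc (Suc m)} (z, w(k := y))" for y and w :: "nat \<Rightarrow> nat \<Rightarrow> real"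
        by (auto simp: merge_def fun_eq_iff less_Suc_eq)
      then show ?thesis by simp
    qed
    also have "\<dots> = (\<integral>\<^sup>+w. indicator A (merge {..<k} {k..<k + Suc (Suc m)} (z, w)) \<partial>(\<Pi>\<^sub>M i\<in>insert k ?J. N i))"
      using meas[OF Suc.prems(2,3)] unfolding ins
      by (intro N.product_nn_integral_insert_rev[symmetric]) auto
    finally show ?case unfolding ins .
  }
qed

text \<open>A non-interactive mechanism is the special case in which each kernel discards the
  earlier views, so privacy of the single kernel \<open>k\<close> suffices.\<close>

lemma seq_interactive_PiM_kernel:
  assumes n: "1 \<le> n" and k: "k \<in> M \<rightarrow>\<^sub>M prob_algebra (view_space q)"
    and priv: "\<And>A x x'. A \<in> sets (view_space q) \<Longrightarrow> x \<in> space M \<Longrightarrow> x' \<in> space M \<Longrightarrow>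
      measure (k x) A \<le> exp \<alpha> * measure (k x') A"
  shows "seq_interactive \<alpha> M n q (\<lambda>x. \<Pi>\<^sub>M i\<in>{..<n}. k (x i))"
  unfolding seq_interactive_def
proof (intro exI[of _ "\<lambda>_ p. k (fst p)"] conjI allI impI ballI)
  show "(\<lambda>p. k (fst p)) \<in> M \<Otimes>\<^sub>M views q i \<rightarrow>\<^sub>M prob_algebra (view_space q)" for i
    by (rule measurable_compose[OF measurable_fst k])
  show "measure (k (fst (x, z))) A \<le> exp \<alpha> * measure (k (fst (x', z))) A"
    if "A \<in> sets (view_space q)" "x \<in> space M" "x' \<in> space M" for A x x' and z :: "nat \<Rightarrow> nat \<Rightarrow> real"
    using priv[OF that] by simp
  fix A x assume A: "A \<in> sets (views q n)" and x: "x \<in> space (\<Pi>\<^sub>M i\<in>{..<n}. M)"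
  have kx: "prob_space (k (x i))" "sets (k (x i)) = sets (view_space q)" if "i < n" for i
  proof -
    have "x i \<in> space M" using x that by (auto simp: space_PiM)
    then show "prob_space (k (x i))" "sets (k (x i)) = sets (view_space q)"
      using measurable_space[OF k] by (auto simp: space_prob_algebra)
  qed
  \<comment> \<open>\<open>iterated_kernel_product\<close> wants probability measures at all
    indices, but \<open>x i\<close> need not lie in \<open>space M\<close> for
    \<open>i \<ge> n\<close>; index 0 is a valid substitute as \<open>1 \<le> n\<close>.\<close>
  define N where "N i = k (x (if i < n then i else 0))" for i
  have N: "prob_space (N i)" "sets (N i) = sets (view_space q)" for i
    using n kx by (auto simp: N_def)
  have PN: "(\<Pi>\<^sub>M i\<in>{..<n}. k (x i)) = (\<Pi>\<^sub>M i\<in>{..<n}. N i)" by (rule PiM_cong) (auto simp: N_def)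
  \<comment> \<open>Start with an empty prefix. Since \<open>1 \<le> n\<close>,
    \<open>Suc (n - 1)\<close> equals \<open>n\<close>, so the tail covers all coordinates.\<close>
  have "iterated_kernel q (\<lambda>_ p. k (fst p)) x A (n - 1) 0 (\<lambda>_. undefined)
      = (\<integral>\<^sup>+w. indicator A (merge {..<0} {0..<0 + Suc (n - 1)} (\<lambda>_. undefined, w)) \<partial>(\<Pi>\<^sub>M i\<in>{0..<0 + Suc (n - 1)}. N i))"
    by (rule iterated_kernel_product[OF N]) (use n A in \<open>auto simp: N_def space_PiM\<close>)
  also have "\<dots> = (\<integral>\<^sup>+w. indicator A (merge {} {..<n} (\<lambda>_. undefined, w)) \<partial>(\<Pi>\<^sub>M i\<in>{..<n}. N i))"
    using n by (simp add: atLeast0LessThan)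
  also have "\<dots> = (\<integral>\<^sup>+w. indicator A w \<partial>(\<Pi>\<^sub>M i\<in>{..<n}. N i))"
  proof (rule nn_integral_cong)
    fix w assume "w \<in> space (\<Pi>\<^sub>M i\<in>{..<n}. N i)"
    then have "merge {} {..<n} (\<lambda>_. undefined, w) = w"
      by (auto simp: space_PiM merge_def fun_eq_iff PiE_iff extensional_def)
    then show "indicator A (merge {} {..<n} (\<lambda>_. undefined, w)) = (indicator A w :: ennreal)" by simp
  qed
  also have "\<dots> = emeasure (\<Pi>\<^sub>M i\<in>{..<n}. k (x i)) A"
    unfolding PN using A sets_PiM_cong[of "{..<n}" "{..<n}" N "\<lambda>_. view_space q"] N(2) by simp
  finally show "emeasure (\<Pi>\<^sub>M i\<in>{..<n}. k (x i)) A = iterated_kernel q (\<lambda>_ p. k (fst p)) x A (n - 1) 0 (\<lambda>_. undefined)" ..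
qed

section \<open>Binary randomised responses and their privacy\<close>

definition two_point :: "real \<Rightarrow> real \<Rightarrow> (nat \<Rightarrow> real) measure" where
  "two_point c p = distr (measure_pmf (bernoulli_pmf p)) (view_space 1) (\<lambda>b. \<lambda>_\<in>{..<1}. if b then c else - c)"

lemma sets_two_point [simp]: "sets (two_point c p) = sets (view_space 1)"
  by (simp add: two_point_def)

lemma two_point_measurable: "(\<lambda>b. \<lambda>_\<in>{..<1}. if b then c else - c) \<in> measure_pmf p \<rightarrow>\<^sub>M view_space 1"
  by (auto simp: view_space_def space_PiM)

lemma prob_space_two_point: "prob_space (two_point c p)"
  unfolding two_point_def by (rule prob_space.prob_space_distr[OF prob_space_measure_pmf two_point_measurable])

lemma nn_integral_two_point:
  assumes "0 \<le> p" "p \<le> 1" "g \<in> borel_measurable (view_space 1)"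
  shows "(\<integral>\<^sup>+z. g z \<partial>two_point c p)
    = g (\<lambda>_\<in>{..<1}. c) * ennreal p + g (\<lambda>_\<in>{..<1}. - c) * ennreal (1 - p)"
  using assms two_point_measurable[of c "bernoulli_pmf p"]
  by (simp add: two_point_def nn_integral_distr)

lemma measure_two_point:
  assumes "0 \<le> p" "p \<le> 1" "A \<in> sets (view_space 1)"
  shows "measure (two_point c p) A
    = p * indicator A (\<lambda>_\<in>{..<1}. c) + (1 - p) * indicator A (\<lambda>_\<in>{..<1}. - c)"
proof -
  have "emeasure (two_point c p) A = (\<integral>\<^sup>+z. indicator A z \<partial>two_point c p)" using assms by simp
  also have "\<dots> = ennreal (p * indicator A (\<lambda>_\<in>{..<1}. c) + (1 - p) * indicator A (\<lambda>_\<in>{..<1}. - c))"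
    using assms by (subst nn_integral_two_point) (auto simp: indicator_def ennreal_plus[symmetric] simp del: ennreal_plus)
  finally show ?thesis using assms by (intro measure_eq_emeasure_eq_ennreal) auto
qed

lemma measurable_two_point:
  assumes [measurable]: "p \<in> borel_measurable M" and p: "\<And>x. 0 \<le> p x" "\<And>x. p x \<le> 1"
  shows "(\<lambda>x. two_point c (p x)) \<in> M \<rightarrow>\<^sub>M prob_algebra (view_space 1)"
proof (rule measurable_prob_algebra_generated[OF sets.sigma_sets_eq[symmetric] sets.Int_stable sets.space_closed])
  fix A assume A: "A \<in> sets (view_space 1)"
  have "emeasure (two_point c (p x)) A
      = ennreal (p x * indicator A (\<lambda>_\<in>{..<1}. c) + (1 - p x) * indicator A (\<lambda>_\<in>{..<1}. - c))" for x
    using measure_two_point[OF p A, of c x] prob_space_two_point[of c "p x"]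
    by (simp add: finite_measure.emeasure_eq_measure prob_space_def)
  then show "(\<lambda>x. emeasure (two_point c (p x)) A) \<in> borel_measurable M" by simp
qed (simp_all add: prob_space_two_point)

text \<open>The interval from \<open>1 / (e + 1)\<close> to \<open>e / (e + 1)\<close> is symmetric
  about 1/2 and its endpoints have ratio \<open>e\<close>. Hence the likelihood ratio of each of the
  two outcomes is at most \<open>e\<close>, and adding the outcomes in \<open>A\<close> preserves
  this.\<close>

lemma two_point_ratio:
  assumes p: "1 / (e + 1) \<le> p" "p \<le> e / (e + 1)" and p': "1 / (e + 1) \<le> p'" "p' \<le> e / (e + 1)"
    and e: "1 \<le> e" and A: "A \<in> sets (view_space 1)"
  shows "measure (two_point c p) A \<le> e * measure (two_point c p') A"
proof -
  have range: "0 \<le> t" "t \<le> 1" if "1 / (e + 1) \<le> t" "t \<le> e / (e + 1)" for t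
  proof -
    have "0 \<le> 1 / (e + 1)" "e / (e + 1) \<le> 1" using e by auto
    then show "0 \<le> t" "t \<le> 1" using that by linarith+
  qed
  have ratio: "s \<le> e * t" if "s \<le> e / (e + 1)" "1 / (e + 1) \<le> t" for s t
    using that(1) mult_left_mono[OF that(2), of e] e by simp
  have c: "1 - e / (e + 1) = 1 / (e + 1)" using e by (simp add: field_simps)
  have 1: "p \<le> e * p'" using ratio p p' by simp
  have 2: "1 - p \<le> e * (1 - p')" by (rule ratio) (use p p' c in linarith)+
  show ?thesis
    unfolding measure_two_point[OF range[OF p] A] measure_two_point[OF range[OF p'] A] distrib_left mult.assoc[symmetric]
    using 1 2 by (intro add_mono mult_right_mono) auto
qed

text \<open>A response \<open>\<plusminus>c\<close> with mean \<open>f x\<close> has success probability \<open>(1 + f x / c) / 2\<close>. For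
  \<open>\<bar>f\<bar> \<le> B\<close>, the smallest \<open>c\<close> that keeps the likelihood ratio below \<open>e\<^sup>\<alpha>\<close> is the one chosen here.\<close>

definition response :: "real \<Rightarrow> real \<Rightarrow> ('a \<Rightarrow> real) \<Rightarrow> 'a \<Rightarrow> (nat \<Rightarrow> real) measure" where
  "response \<alpha> B f x = two_point (B * ((exp \<alpha> + 1) / (exp \<alpha> - 1)))
     ((1 + f x / (B * ((exp \<alpha> + 1) / (exp \<alpha> - 1)))) / 2)"

text \<open>The scale \<open>c\<close> is calibrated so that
  \<open>B / c = (e - 1) / (e + 1)\<close>; the extreme success probabilities are then exactly the
  endpoints required by \<open>two_point_ratio\<close>.\<close>

lemma response_probability_bounds:
  fixes e :: real
  assumes e: "1 < e" and B: "0 < B" and y: "\<bar>y\<bar> \<le> B"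
  defines "c \<equiv> B * ((e + 1) / (e - 1))"
  shows "1 / (e + 1) \<le> (1 + y / c) / 2" "(1 + y / c) / 2 \<le> e / (e + 1)"
proof -
  have c: "0 < c" unfolding c_def using e B by (intro mult_pos_pos divide_pos_pos) (auto intro: add_pos_pos)
  have "B / c = (e - 1) / (e + 1)" using e B by (simp add: c_def)
  moreover have "\<bar>y / c\<bar> \<le> B / c" using y c by (simp add: abs_divide divide_right_mono)
  ultimately have "- ((e - 1) / (e + 1)) \<le> y / c" "y / c \<le> (e - 1) / (e + 1)"
    by (simp_all only: abs_le_iff) linarith+
  moreover have "(1 - (e - 1) / (e + 1)) / 2 = 1 / (e + 1)" "(1 + (e - 1) / (e + 1)) / 2 = e / (e + 1)"
    using e by (simp_all add: field_simps)
  moreover have "v \<le> (1 + t) / 2 \<and> (1 + t) / 2 \<le> v'"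
    if "- u \<le> t" "t \<le> u" "(1 - u) / 2 = v" "(1 + u) / 2 = v'" for t u v v' :: real
    using that by auto
  ultimately have "1 / (e + 1) \<le> (1 + y / c) / 2 \<and> (1 + y / c) / 2 \<le> e / (e + 1)"
    by blast
  then show "1 / (e + 1) \<le> (1 + y / c) / 2" "(1 + y / c) / 2 \<le> e / (e + 1)" by auto
qed

lemma
  assumes \<alpha>: "0 < \<alpha>" and B: "0 < B" and f: "f \<in> borel_measurable M" "\<And>x. \<bar>f x\<bar> \<le> B"
  shows measurable_response: "response \<alpha> B f \<in> M \<rightarrow>\<^sub>M prob_algebra (view_space 1)"
    and response_private: "A \<in> sets (view_space 1) \<Longrightarrow>
      measure (response \<alpha> B f x) A \<le> exp \<alpha> * measure (response \<alpha> B f x') A"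
proof -
  define c where "c = B * ((exp \<alpha> + 1) / (exp \<alpha> - 1))"
  have e: "1 < exp \<alpha>" using \<alpha> by simp
  note b = response_probability_bounds[OF e B f(2), folded c_def]
  have r: "response \<alpha> B f = (\<lambda>x. two_point c ((1 + f x / c) / 2))"
    by (simp add: fun_eq_iff response_def c_def)
  have "0 \<le> 1 / (exp \<alpha> + 1)" "exp \<alpha> / (exp \<alpha> + 1) \<le> 1" by (auto simp: add_pos_pos)
  then have "0 \<le> (1 + f x / c) / 2" "(1 + f x / c) / 2 \<le> 1" for x using b[of x] by linarith+
  then show "response \<alpha> B f \<in> M \<rightarrow>\<^sub>M prob_algebra (view_space 1)"
    unfolding r using f(1) by (intro measurable_two_point) auto
  show "measure (response \<alpha> B f x) A \<le> exp \<alpha> * measure (response \<alpha> B f x') A" if "A \<in> sets (view_space 1)"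
    unfolding r using two_point_ratio[OF b b _ that] e by simp
qed

text \<open>Clipping does not change a response; it makes the summands of the estimator bounded
  everywhere instead of almost everywhere.\<close>

lemma expectation_response:
  assumes \<alpha>: "0 < \<alpha>" and B: "0 < B" and f: "f \<in> borel_measurable M" "\<And>x. \<bar>f x\<bar> \<le> B"
    and P: "P \<in> space (prob_algebra M)"
  defines "c \<equiv> B * ((exp \<alpha> + 1) / (exp \<alpha> - 1))"
  shows "(\<integral>z. clip c (z 0) \<partial>(P \<bind> response \<alpha> B f)) = (\<integral>x. f x \<partial>P)"
proof -
  have e: "1 < exp \<alpha>" using \<alpha> by simp
  have c: "0 < c" unfolding c_def using e B by (intro mult_pos_pos divide_pos_pos) (auto intro: add_pos_pos)
  have Bc: "B \<le> c" using e B by (simp add: c_def field_simps)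
  have Pp: "prob_space P" and sP: "sets P = sets M" using P by (auto simp: space_prob_algebra)
  interpret P: prob_space P by fact
  have fP [measurable]: "f \<in> borel_measurable P" using f(1) sP by (simp cong: measurable_cong_sets)
  note k = measurable_response[OF \<alpha> B f]
  have kP: "response \<alpha> B f \<in> P \<rightarrow>\<^sub>M prob_algebra (view_space 1)" using k sP by (simp cong: measurable_cong_sets)
  have PP: "P \<in> space (prob_algebra P)" using Pp by (simp add: space_prob_algebra)
  interpret R: prob_space "P \<bind> response \<alpha> B f" using prob_space_bind'[OF PP kP] .
  have sR: "sets (P \<bind> response \<alpha> B f) = sets (view_space 1)" using sets_bind'[OF PP kP] .
  have m [measurable]: "(\<lambda>z. clip c (z 0)) \<in> borel_measurable (view_space 1)"
    unfolding view_space_def by measurable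
  have mR: "(\<lambda>z. clip c (z 0)) \<in> borel_measurable (P \<bind> response \<alpha> B f)"
    using m sR by (simp cong: measurable_cong_sets)
  have cl: "\<bar>clip c y\<bar> \<le> c" for y using c abs_clip_le by simp
  have nn: "0 \<le> clip c y + c" "0 \<le> f x + c" for x y
    using cl[of y] f(2)[of x] Bc by linarith+
  have iR: "integrable (P \<bind> response \<alpha> B f) (\<lambda>z. clip c (z 0))"
    using mR cl by (intro R.integrable_const_bound[where B=c]) auto
  have iP: "integrable P f" using f(2) by (intro P.integrable_const_bound[where B=B]) auto
  have mg: "(\<lambda>z. ennreal (clip c (z 0) + c)) \<in> borel_measurable (view_space 1)" by measurable
  \<comment> \<open>Shifting by \<open>c\<close> makes the integrand nonnegative, so that the
    integral over the bind can be evaluated in the extended reals. Only the outcome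
    \<open>+c\<close> contributes, giving \<open>2 * c * p = f x + c\<close>; the shift is cancelled
    at the end.\<close>
  have inner: "(\<integral>\<^sup>+z. ennreal (clip c (z 0) + c) \<partial>response \<alpha> B f x) = ennreal (f x + c)" for x
  proof -
    define p where "p = (1 + f x / c) / 2"
    have "0 \<le> 1 / (exp \<alpha> + 1)" "exp \<alpha> / (exp \<alpha> + 1) \<le> 1" by (auto simp: add_pos_pos)
    then have p: "0 \<le> p" "p \<le> 1"
      using response_probability_bounds[OF e B f(2), of x, folded c_def] unfolding p_def by linarith+
    have "(\<integral>\<^sup>+z. ennreal (clip c (z 0) + c) \<partial>response \<alpha> B f x) = ennreal (2 * c) * ennreal p"
      unfolding response_def c_def[symmetric] p_def[symmetric]
      using c by (subst nn_integral_two_point[OF p mg]) (simp add: clip_def)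
    also have "\<dots> = ennreal (2 * c * p)" using c p by (simp add: ennreal_mult)
    also have "2 * c * p = f x + c" using c by (simp add: p_def field_simps)
    finally show ?thesis .
  qed
  have "(\<integral>\<^sup>+z. ennreal (clip c (z 0) + c) \<partial>(P \<bind> response \<alpha> B f)) = (\<integral>\<^sup>+x. ennreal (f x + c) \<partial>P)"
    by (simp add: nn_integral_bind[OF mg measurable_prob_algebraD[OF kP]] inner)
  moreover have "(\<integral>\<^sup>+z. ennreal (clip c (z 0) + c) \<partial>(P \<bind> response \<alpha> B f))
      = ennreal (\<integral>z. clip c (z 0) + c \<partial>(P \<bind> response \<alpha> B f))"
    using iR nn by (intro nn_integral_eq_integral) auto
  moreover have "(\<integral>\<^sup>+x. ennreal (f x + c) \<partial>P) = ennreal (\<integral>x. f x + c \<partial>P)"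
    using iP nn by (intro nn_integral_eq_integral) auto
  moreover have "0 \<le> (\<integral>z. clip c (z 0) + c \<partial>(P \<bind> response \<alpha> B f))"
    by (rule Bochner_Integration.integral_nonneg) (rule nn)
  moreover have "0 \<le> (\<integral>x. f x + c \<partial>P)"
    by (rule Bochner_Integration.integral_nonneg) (rule nn)
  ultimately have "(\<integral>z. clip c (z 0) + c \<partial>(P \<bind> response \<alpha> B f)) = (\<integral>x. f x + c \<partial>P)" by simp
  then show ?thesis using iR iP R.prob_space P.prob_space by simp
qed

section \<open>Concentration of the averaged responses\<close>

text \<open>Hoeffding's inequality for the coordinates of a product measure. Each summand ranges
  over an interval of length \<open>2 * c\<close>, which turns the exponent into
  \<open>real n * \<tau>\<^sup>2 / (2 * c\<^sup>2)\<close>.\<close>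

lemma iid_mean_deviation:
  fixes R :: "'a measure" and \<phi> :: "'a \<Rightarrow> real"
  assumes R: "prob_space R" and \<phi> [measurable]: "\<phi> \<in> borel_measurable R" and c: "0 < c" "\<And>y. \<bar>\<phi> y\<bar> \<le> c"
    and n: "1 \<le> n" and \<tau>: "0 \<le> \<tau>"
  shows "measure (\<Pi>\<^sub>M i\<in>{..<n}. R)
      {z \<in> space (\<Pi>\<^sub>M i\<in>{..<n}. R). \<tau> \<le> \<bar>(\<Sum>i<n. \<phi> (z i)) / real n - (\<integral>y. \<phi> y \<partial>R)\<bar>}
    \<le> 2 * exp (- (real n * \<tau>\<^sup>2 / (2 * c\<^sup>2)))"
proof -
  let ?M = "\<Pi>\<^sub>M i\<in>{..<n}. R"
  interpret R: prob_space R by fact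
  interpret M: prob_space ?M by (rule prob_space_PiM) (rule R)
  have ne: "{..<n} \<noteq> {}" using n by (auto simp: lessThan_empty_iff)
  have comp: "distr ?M R (\<lambda>z. z i) = R" if "i < n" for i
    using distr_PiM_component[of "{..<n}" "\<lambda>_. R" i] R that by simp
  have "M.indep_vars (\<lambda>_. R) (\<lambda>i z. z i) {..<n}"
  \<comment> \<open>Independence amounts to the joint law being the product of the marginals; here
    the joint map is the identity and every marginal is \<open>R\<close>.\<close>
  proof (subst M.indep_vars_iff_distr_eq_PiM'[OF ne])
    have "distr ?M ?M (\<lambda>z. \<lambda>i\<in>{..<n}. z i) = distr ?M ?M (\<lambda>z. z)"
      by (rule distr_cong) (auto simp: space_PiM)
    also have "\<dots> = ?M" by (rule distr_id2) simp
    also have "\<dots> = (\<Pi>\<^sub>M i\<in>{..<n}. distr ?M R (\<lambda>z. z i))"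
      by (rule PiM_cong) (auto simp: comp)
    finally show "distr ?M ?M (\<lambda>z. \<lambda>i\<in>{..<n}. z i) = (\<Pi>\<^sub>M i\<in>{..<n}. distr ?M R (\<lambda>z. z i))" .
  qed auto
  then have ind: "M.indep_vars (\<lambda>_. borel) (\<lambda>i z. \<phi> (z i)) {..<n}"
    by (rule M.indep_vars_compose2) simp
  interpret H: indep_interval_bounded_random_variables ?M "{..<n}" "\<lambda>i z. \<phi> (z i)" "\<lambda>_. - c" "\<lambda>_. c"
    using c(2) by unfold_locales (auto simp: ind abs_le_iff minus_le_iff)
  interpret H: Hoeffding_ineq ?M "{..<n}" "\<lambda>i z. \<phi> (z i)" "\<lambda>_. - c" "\<lambda>_. c" "\<Sum>i<n. M.expectation (\<lambda>z. \<phi> (z i))"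
    by unfold_locales
  have ex: "M.expectation (\<lambda>z. \<phi> (z i)) = (\<integral>y. \<phi> y \<partial>R)" if "i < n" for i
  proof -
    have "(\<integral>y. \<phi> y \<partial>distr ?M R (\<lambda>z. z i)) = M.expectation (\<lambda>z. \<phi> (z i))"
      using that by (intro integral_distr) auto
    then show ?thesis by (simp add: comp[OF that])
  qed
  have "measure ?M {z \<in> space ?M. real n * \<tau> \<le> \<bar>(\<Sum>i<n. \<phi> (z i)) - (\<Sum>i<n. M.expectation (\<lambda>z. \<phi> (z i)))\<bar>}
    \<le> 2 * exp (- 2 * (real n * \<tau>)\<^sup>2 / (\<Sum>i<n. (c - - c)\<^sup>2))"
    using \<tau> c n by (intro H.Hoeffding_ineq_abs_ge) auto
  also have "- 2 * (real n * \<tau>)\<^sup>2 / (\<Sum>i<n. (c - - c)\<^sup>2) = - (real n * \<tau>\<^sup>2 / (2 * c\<^sup>2))"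
    using n c by (simp add: power2_eq_square field_simps)
  also have "{z \<in> space ?M. real n * \<tau> \<le> \<bar>(\<Sum>i<n. \<phi> (z i)) - (\<Sum>i<n. M.expectation (\<lambda>z. \<phi> (z i)))\<bar>}
    = {z \<in> space ?M. \<tau> \<le> \<bar>(\<Sum>i<n. \<phi> (z i)) / real n - (\<integral>y. \<phi> y \<partial>R)\<bar>}"
  proof -
    have "real n * \<tau> \<le> \<bar>s - (\<Sum>i<n. M.expectation (\<lambda>z. \<phi> (z i)))\<bar> \<longleftrightarrow> \<tau> \<le> \<bar>s / real n - (\<integral>y. \<phi> y \<partial>R)\<bar>" for s
    proof -
      have "\<bar>s - (\<Sum>i<n. M.expectation (\<lambda>z. \<phi> (z i)))\<bar> = \<bar>real n * (s / real n - (\<integral>y. \<phi> y \<partial>R))\<bar>"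
        using n ex by (simp add: algebra_simps)
      also have "\<dots> = real n * \<bar>s / real n - (\<integral>y. \<phi> y \<partial>R)\<bar>" by (simp add: abs_mult)
      finally show ?thesis using n by simp
    qed
    then show ?thesis by simp
  qed
  finally show ?thesis .
qed

section \<open>Risk of the averaged responses\<close>

lemma growth_power:
  fixes l :: "real \<Rightarrow> real"
  assumes "\<And>t. 0 \<le> t \<Longrightarrow> l (3 / 2 * t) \<le> a * l t" "0 \<le> a" "0 \<le> w"
  shows "l ((3 / 2) ^ k * w) \<le> a ^ k * l w"
proof (induction k)
  case (Suc k)
  have "l ((3 / 2) ^ Suc k * w) \<le> a * l ((3 / 2) ^ k * w)"
    using assms(1)[of "(3 / 2) ^ k * w"] assms(3) by (simp add: mult.assoc)
  also have "\<dots> \<le> a * (a ^ k * l w)" using Suc.IH assms(2) by (rule mult_left_mono)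
  finally show ?case by (simp add: mult.assoc)
qed simp

text \<open>On the k-th shell beyond \<open>(3/2)^N * w\<close> the loss is at most
  \<open>a ^ (N + k + 1) * l w\<close>, while the probability of reaching it is at most
  \<open>2 * (1 / (2 * a)) ^ k\<close>. The factors \<open>a ^ k\<close> cancel and a geometric
  series of ratio 1/2 remains.\<close>

lemma nn_integral_loss_le:
  fixes l :: "real \<Rightarrow> real"
  assumes l: "\<And>t. 0 \<le> t \<Longrightarrow> 0 \<le> l t" "mono_on {0..} l" "\<And>t. 0 \<le> t \<Longrightarrow> l (3 / 2 * t) \<le> a * l t"
    and a: "1 < a" and w: "0 < w" and N: "1 \<le> N" "2 * ln (2 * a) \<le> (3 / 2) ^ N"
    and S: "prob_space S" and err [measurable]: "err \<in> borel_measurable S" and err_nn: "\<And>z. 0 \<le> err z"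
    and tail: "\<And>\<tau>. 0 \<le> \<tau> \<Longrightarrow>
      measure S {z \<in> space S. (3 / 4 + \<tau>) * w \<le> err z} \<le> 2 * exp (- (32 * \<tau>\<^sup>2))"
  shows "(\<integral>\<^sup>+z. ennreal (l (err z)) \<partial>S) \<le> ennreal ((1 + 8 * a\<^sup>2 / (2 * a - 1)) * a ^ N * l w)"
proof -
  interpret S: prob_space S by fact
  have lw: "0 \<le> l w" using l(1) w by simp
  have l_le: "l x \<le> a ^ k * l w" if "0 \<le> x" "x \<le> (3 / 2) ^ k * w" for x k
  proof -
    have "l x \<le> l ((3 / 2) ^ k * w)" using that w by (intro mono_onD[OF l(2)]) auto
    also have "\<dots> \<le> a ^ k * l w" using growth_power[where l=l and a=a, OF l(3)] a w by simp
    finally show ?thesis .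
  qed
  define T where "T k = {z \<in> space S. (3 / 2) ^ (N + k) * w \<le> err z}" for k
  have T [measurable]: "T k \<in> sets S" for k unfolding T_def by measurable
  have pointwise: "ennreal (l (err z))
      \<le> ennreal (a ^ N * l w) + (\<Sum>k. ennreal (a ^ (N + k + 1) * l w) * indicator (T k) z)"
    if z: "z \<in> space S" for z
  proof (cases "err z \<le> (3 / 2) ^ N * w")
    case True
    then have "ennreal (l (err z)) \<le> ennreal (a ^ N * l w)" by (intro ennreal_leI l_le err_nn)
    then show ?thesis by (rule order_trans) simp
  next
    case False
    obtain j where "err z / w < (3 / 2) ^ j" using real_arch_pow[of "3 / 2" "err z / w"] by auto
    also have "(3 / 2) ^ j \<le> (3 / 2 :: real) ^ (N + j)" by (rule power_increasing) auto
    finally have j: "err z \<le> (3 / 2) ^ (N + j) * w" using w by (simp add: field_simps)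
    \<comment> \<open>By minimality the error exceeds the previous threshold, so the point lies in
      \<open>T k\<close> with \<open>m = Suc k\<close>; the value at \<open>m\<close> bounds the
      loss and the whole series dominates this one term.\<close>
    define m where "m = (LEAST j. err z \<le> (3 / 2) ^ (N + j) * w)"
    have m: "err z \<le> (3 / 2) ^ (N + m) * w" unfolding m_def by (rule LeastI[of _ j]) (rule j)
    have "m \<noteq> 0"
    proof
      assume "m = 0"
      with m False show False by simp
    qed
    then obtain k where k: "m = Suc k" by (cases m) auto
    have "\<not> err z \<le> (3 / 2) ^ (N + k) * w"
      using not_less_Least[of k "\<lambda>j. err z \<le> (3 / 2) ^ (N + j) * w", folded m_def] k by simp
    then have "z \<in> T k" using z by (simp add: T_def)
    then have "ennreal (l (err z)) \<le> ennreal (a ^ (N + k + 1) * l w) * indicator (T k) z"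
      using l_le[OF err_nn m] by (simp add: k ennreal_leI)
    also have "\<dots> \<le> (\<Sum>k. ennreal (a ^ (N + k + 1) * l w) * indicator (T k) z)"
    proof -
      have "h k \<le> suminf h" for h :: "nat \<Rightarrow> ennreal" using sum_le_suminf[of h "{k}"] by simp
      then show ?thesis .
    qed
    finally show ?thesis by (rule order_trans) simp
  qed
  have prob_T: "measure S (T k) \<le> 2 * (1 / (2 * a)) ^ k" for k
  proof -
    define x where "x = (3 / 2 :: real) ^ (N + k)"
    \<comment> \<open>The hypothesis \<open>1 \<le> N\<close> enters here:
      \<open>x \<ge> 3 / 2\<close> lets half of the threshold absorb the bias term 3/4.\<close>
    have "(3 / 2 :: real) ^ 1 \<le> x" unfolding x_def using N(1) by (intro power_increasing) auto
    then have x: "3 / 2 \<le> x" by simp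
    \<comment> \<open>The lower bound on \<open>(3/2) ^ N\<close> supplies the factor
      \<open>2 * ln (2 * a)\<close>, and Bernoulli's inequality bounds the remaining factor
      \<open>k / 2\<close> by \<open>(3/2) ^ k\<close>.\<close>
    have "real k * ln (2 * a) \<le> x"
    proof -
      have "1 + real k * (1 / 2) \<le> (1 + 1 / 2 :: real) ^ k" by (rule Bernoulli_inequality) simp
      then have bern: "real k / 2 \<le> (3 / 2) ^ k" by simp
      have "real k * ln (2 * a) = (2 * ln (2 * a)) * (real k / 2)" by simp
      also have "\<dots> \<le> (3 / 2) ^ N * (3 / 2) ^ k" using N(2) bern a by (intro mult_mono) auto
      finally show ?thesis by (simp add: x_def power_add)
    qed
    \<comment> \<open>Since \<open>x - 3 / 4 \<ge> x / 2\<close>, the right side is at least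
      \<open>8 * x\<^sup>2\<close>, which exceeds \<open>x\<close>.\<close>
    also have "x \<le> 32 * (x - 3 / 4)\<^sup>2"
    proof -
      have "x * 1 \<le> x * (8 * x)" using x by (intro mult_left_mono) auto
      also have "\<dots> = 32 * (x / 2)\<^sup>2" by (simp add: power2_eq_square)
      also have "\<dots> \<le> 32 * (x - 3 / 4)\<^sup>2" using x by (intro mult_left_mono power_mono) auto
      finally show ?thesis by simp
    qed
    finally have "exp (- (32 * (x - 3 / 4)\<^sup>2)) \<le> exp (real k * (- ln (2 * a)))" by simp
    also have "\<dots> = (1 / (2 * a)) ^ k"
      unfolding exp_of_nat_mult using a by (simp add: exp_minus inverse_eq_divide)
    finally have "exp (- (32 * (x - 3 / 4)\<^sup>2)) \<le> (1 / (2 * a)) ^ k" .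
    then show ?thesis
      using tail[of "x - 3 / 4"] x by (simp add: T_def x_def[symmetric])
  qed
  have "(\<integral>\<^sup>+z. ennreal (l (err z)) \<partial>S)
      \<le> (\<integral>\<^sup>+z. ennreal (a ^ N * l w) + (\<Sum>k. ennreal (a ^ (N + k + 1) * l w) * indicator (T k) z) \<partial>S)"
    by (rule nn_integral_mono) (rule pointwise)
  also have "\<dots> = ennreal (a ^ N * l w) + (\<Sum>k. ennreal (a ^ (N + k + 1) * l w) * emeasure S (T k))"
    by (subst nn_integral_add) (auto simp: nn_integral_suminf nn_integral_cmult_indicator S.emeasure_space_1)
  also have "\<dots> \<le> ennreal (a ^ N * l w) + (\<Sum>k. ennreal ((2 * a * a ^ N * l w) * (1 / 2) ^ k))"
  proof (intro add_left_mono suminf_le)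
    fix k
    have "ennreal (a ^ (N + k + 1) * l w) * emeasure S (T k) = ennreal (a ^ (N + k + 1) * l w * measure S (T k))"
      using a lw by (simp add: S.emeasure_eq_measure ennreal_mult)
    also have "\<dots> \<le> ennreal (a ^ (N + k + 1) * l w * (2 * (1 / (2 * a)) ^ k))"
      using prob_T a lw by (intro ennreal_leI mult_left_mono) auto
    also have "a ^ (N + k + 1) * l w * (2 * (1 / (2 * a)) ^ k) = (2 * a * a ^ N * l w) * (1 / 2) ^ k"
      using a by (simp add: power_add power_divide power_mult_distrib field_simps)
    finally show "ennreal (a ^ (N + k + 1) * l w) * emeasure S (T k) \<le> ennreal ((2 * a * a ^ N * l w) * (1 / 2) ^ k)" .
  qed auto
  also have "(\<Sum>k. ennreal ((2 * a * a ^ N * l w) * (1 / 2) ^ k)) = ennreal ((2 * a * a ^ N * l w) * 2)"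
    using a lw sums_mult[OF geometric_sums[of "1 / 2 :: real"], of "2 * a * a ^ N * l w"]
    by (intro suminf_ennreal_eq) (auto simp: mult.commute)
  also have "ennreal (a ^ N * l w) + \<dots> = ennreal ((1 + 4 * a) * (a ^ N * l w))"
    using a lw by (simp add: ennreal_plus[symmetric] algebra_simps del: ennreal_plus)
  also have "\<dots> \<le> ennreal ((1 + 8 * a\<^sup>2 / (2 * a - 1)) * (a ^ N * l w))"
  proof (intro ennreal_leI mult_right_mono)
    \<comment> \<open>After clearing the positive denominator this is
      \<open>8 * a\<^sup>2 - 4 * a \<le> 8 * a\<^sup>2\<close>.\<close>
    show "1 + 4 * a \<le> 1 + 8 * a\<^sup>2 / (2 * a - 1)" using a by (simp add: field_simps power2_eq_square)
  qed (use a lw in simp)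
  finally show ?thesis by (simp add: mult.assoc)
qed

text \<open>All three infima are bounded by explicit choices: \<open>q = 1\<close>, the product of
  the response kernels, and \<open>est\<close>. By \<open>bind_PiM_kernel\<close> the risk only has
  to be checked under an i.i.d. law.\<close>

lemma private_minimax_risk_response_le:
  assumes \<alpha>: "0 < \<alpha>" and n: "1 \<le> n" and \<P>: "\<P> \<subseteq> space (prob_algebra M)"
    and B: "0 < B" and f: "f \<in> borel_measurable M" "\<And>x. \<bar>f x\<bar> \<le> B"
    and est: "est \<in> borel_measurable (views 1 n)"
    and risk: "\<And>P. P \<in> \<P> \<Longrightarrow>
      (\<integral>\<^sup>+z. ennreal (l \<bar>est z - \<theta> P\<bar>) \<partial>(\<Pi>\<^sub>M i\<in>{..<n}. P \<bind> response \<alpha> B f)) \<le> b"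
  shows "private_minimax_risk l n \<alpha> M \<P> \<theta> \<le> b"
proof -
  note k = measurable_response[OF \<alpha> B f]
  define Q where "Q = (\<lambda>x. \<Pi>\<^sub>M i\<in>{..<n}. response \<alpha> B f (x i))"
  have "Q \<in> channels M n 1"
    unfolding Q_def channels_def by (rule measurable_PiM_kernel[OF _ k]) simp
  moreover have "seq_interactive \<alpha> M n 1 Q"
    unfolding Q_def using response_private[OF \<alpha> B f] by (intro seq_interactive_PiM_kernel[OF n k])
  moreover have "minimax_risk l n 1 Q \<P> \<theta> \<le> b"
    unfolding minimax_risk_def
  proof (rule INF_lower2[OF est], rule SUP_least)
    fix P assume P: "P \<in> \<P>"
    have "(\<Pi>\<^sub>M i\<in>{..<n}. P) \<bind> Q = (\<Pi>\<^sub>M i\<in>{..<n}. P \<bind> response \<alpha> B f)"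
      unfolding Q_def using P \<P> by (intro bind_PiM_kernel[OF _ _ k]) auto
    then show "(\<integral>\<^sup>+z. ennreal (l \<bar>est z - \<theta> P\<bar>) \<partial>((\<Pi>\<^sub>M i\<in>{..<n}. P) \<bind> Q)) \<le> b"
      using risk[OF P] by simp
  qed
  ultimately show ?thesis
    unfolding private_minimax_risk_def by (intro INF_lower2[of 1] INF_lower2[of Q]) auto
qed

theorem corollary4p3:
  fixes \<alpha> a C C1 :: real and n :: nat
    and M :: "'a measure" and \<P> :: "'a measure set"
    and \<theta> :: "'a measure \<Rightarrow> real" and l :: "real \<Rightarrow> real"
  assumes "\<alpha> > 0" and "n \<ge> 1"
    and "\<P> \<noteq> {}" and "\<P> \<subseteq> space (prob_algebra M)"
    and "convex_measures \<P>" and "dominated_measures M \<P>"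
    and "linear_functional_on \<P> \<theta>" and "bdd_above ((\<lambda>P. \<bar>\<theta> P\<bar>) ` \<P>)"
    and "\<And>t. t \<ge> 0 \<Longrightarrow> l t \<ge> 0" and "mono_on {0..} l" and "l 0 = 0"
    and "a > 1" and "\<And>t. t \<ge> 0 \<Longrightarrow> l (3 / 2 * t) \<le> a * l t"
  defines "C \<equiv> sqrt (2 * ln (2 * a)) + 1"
    and "C1 \<equiv> (1 + 8 * a\<^sup>2 / (2 * a - 1)) * a powi (\<lceil>2 * ln C / ln (3 / 2)\<rceil> + 1)"
  shows "private_minimax_risk l n \<alpha> M \<P> \<theta> \<le>
           ennreal (C1 * l (omega_TV \<P> \<theta> (4 / sqrt (real n) * ((exp \<alpha> + 1) / (exp \<alpha> - 1)))))"
proof -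
  note \<alpha> = assms(1) and n = assms(2) and ne = assms(3) and \<P> = assms(4) and a = assms(12)
  define \<rho> where "\<rho> = (exp \<alpha> + 1) / (exp \<alpha> - 1)"
  define \<epsilon> where "\<epsilon> = 4 / sqrt (real n) * \<rho>"
  define w where "w = omega_TV \<P> \<theta> \<epsilon>"
  have \<rho>: "0 < \<rho>" unfolding \<rho>_def using \<alpha> by (intro divide_pos_pos) (auto intro: add_pos_pos)
  have \<epsilon>: "0 < \<epsilon>" unfolding \<epsilon>_def using \<rho> n by (intro mult_pos_pos divide_pos_pos) auto
  note diff_le = linear_functional_diff_le[OF \<P> assms(5,7,8) _ _ \<epsilon>, folded w_def]
  obtain P\<^sub>0 where P0: "P\<^sub>0 \<in> \<P>" using ne by auto
  have w_nn: "0 \<le> w"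
  proof -
    have "tv_dist P\<^sub>0 P\<^sub>0 \<le> \<epsilon>" using \<epsilon> by (intro tv_dist_least) simp
    from omega_TV_upper[OF assms(8) P0 P0 this] show ?thesis by (simp add: w_def)
  qed
  have "private_minimax_risk l n \<alpha> M \<P> \<theta> \<le> ennreal (C1 * l w)"
  \<comment> \<open>If the modulus vanishes, \<open>diff_le\<close> makes \<theta> constant on the
    family. The constant estimator then has no error under any channel, and \<open>l 0 = 0\<close>
    closes the case.\<close>
  proof (cases "w = 0")
    case True
    show ?thesis
    proof (rule private_minimax_risk_response_le[OF \<alpha> n \<P>, where B=1 and f="\<lambda>_. 0" and est="\<lambda>_. \<theta> P\<^sub>0"])
      fix P assume "P \<in> \<P>"
      then have "\<theta> P\<^sub>0 - \<theta> P = 0" using diff_le[OF P0] True by simp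
      then show "(\<integral>\<^sup>+z. ennreal (l \<bar>\<theta> P\<^sub>0 - \<theta> P\<bar>) \<partial>(\<Pi>\<^sub>M i\<in>{..<n}. P \<bind> response \<alpha> 1 (\<lambda>_. 0)))
          \<le> ennreal (C1 * l w)" using assms(11) by simp
    qed auto
  next
    case False
    then have w: "0 < w" using w_nn by simp
    define B where "B = w / (2 * \<epsilon>)"
    have B: "0 < B" using w \<epsilon> by (simp add: B_def)
    define c where "c = B * \<rho>"
    have c: "0 < c" using B \<rho> by (simp add: c_def)
    \<comment> \<open>With slack \<open>\<delta> = w / 2\<close> the bias is at most
      \<open>(w + w / 2) / 2 = 3 / 4 * w\<close>, matching the offset in the tail hypothesis of
      \<open>nn_integral_loss_le\<close>.\<close>
    obtain f c\<^sub>0 where f: "f \<in> borel_measurable M" "\<And>x. \<bar>f x\<bar> \<le> B"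
      and bias: "\<And>P. P \<in> \<P> \<Longrightarrow> \<bar>\<theta> P - (\<integral>x. f x \<partial>P) - c\<^sub>0\<bar> \<le> (w + w / 2) / 2"
      using bounded_expectation_approximation[OF ne \<P> assms(5-8) \<epsilon>, of "w / 2"] w
      unfolding B_def w_def[symmetric] by auto
    define est where "est z = c\<^sub>0 + (\<Sum>i<n. clip c (z i 0)) / real n" for z :: "nat \<Rightarrow> nat \<Rightarrow> real"
    \<comment> \<open>The exponent of the constant as a natural number. Its ceiling part is
      nonnegative because \<open>C > 1\<close>, and the added 1 guarantees
      \<open>1 \<le> N\<close>.\<close>
    define N where "N = nat (\<lceil>2 * ln C / ln (3 / 2)\<rceil> + 1)"
    have C: "1 < C" using a by (simp add: C_def)
    have ceil: "0 \<le> \<lceil>2 * ln C / ln (3 / 2)\<rceil>"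
    proof -
      have "0 \<le> 2 * ln C / ln (3 / 2)" using C by (intro divide_nonneg_nonneg) auto
      then show ?thesis by linarith
    qed
    have N: "1 \<le> N" "a powi (\<lceil>2 * ln C / ln (3 / 2)\<rceil> + 1) = a ^ N"
      using ceil unfolding N_def by (linarith, simp add: power_int_def)
    \<comment> \<open>This explains \<open>C\<close> and the exponent: \<open>C\<^sup>2\<close>
      dominates \<open>2 * ln (2 * a)\<close>, and \<open>(3/2) ^ N\<close> dominates
      \<open>C\<^sup>2\<close> by the choice of the ceiling.\<close>
    have "2 * ln (2 * a) \<le> C\<^sup>2"
    proof -
      have "2 * ln (2 * a) = (sqrt (2 * ln (2 * a)))\<^sup>2" using a by simp
      also have "\<dots> \<le> C\<^sup>2" unfolding C_def using a by (intro power_mono) auto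
      finally show ?thesis .
    qed
    also have "C\<^sup>2 = exp (2 * ln C)" using C by (simp add: exp_double)
    also have "\<dots> \<le> exp (real N * ln (3 / 2))"
    proof -
      have "2 * ln C / ln (3 / 2) \<le> real_of_int (\<lceil>2 * ln C / ln (3 / 2)\<rceil>)" by (rule le_of_int_ceiling)
      also have "\<dots> \<le> real N" using ceil by (simp add: N_def)
      finally show ?thesis by (simp add: pos_divide_le_eq)
    qed
    also have "\<dots> = (3 / 2) ^ N" by (simp add: exp_of_nat_mult)
    finally have N2: "2 * ln (2 * a) \<le> (3 / 2) ^ N" .
    have comp: "(\<lambda>y. clip c (y 0)) \<in> borel_measurable (view_space 1)"
      unfolding view_space_def by measurable
    show ?thesis
    proof (rule private_minimax_risk_response_le[OF \<alpha> n \<P> B f, where est=est])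
      have "(\<lambda>z. clip c (z i 0)) \<in> borel_measurable (views 1 n)" if "i < n" for i
        using that by (intro measurable_compose[OF measurable_component_singleton[where M="\<lambda>_. view_space 1"] comp]) simp
      then show est_m: "est \<in> borel_measurable (views 1 n)"
        unfolding est_def by (intro borel_measurable_add borel_measurable_divide borel_measurable_sum) auto
      fix P assume P: "P \<in> \<P>"
      define R where "R = P \<bind> response \<alpha> B f"
      have PM: "P \<in> space (prob_algebra M)" using P \<P> by auto
      note k = measurable_response[OF \<alpha> B f]
      have R: "prob_space R" "sets R = sets (view_space 1)"
        unfolding R_def by (rule prob_space_bind'[OF PM k], rule sets_bind'[OF PM k])
      have mean: "(\<integral>z. clip c (z 0) \<partial>R) = (\<integral>x. f x \<partial>P)"
        using expectation_response[OF \<alpha> B f PM] by (simp add: R_def c_def \<rho>_def)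
      have compR: "(\<lambda>y. clip c (y 0)) \<in> borel_measurable R" using comp R(2) by (simp cong: measurable_cong_sets)
      let ?S = "\<Pi>\<^sub>M i\<in>{..<n}. R"
      have S: "prob_space ?S" by (rule prob_space_PiM) (rule R)
      have setsS: "sets ?S = sets (views 1 n)" by (rule sets_PiM_cong) (auto simp: R(2))
      have estS [measurable]: "est \<in> borel_measurable ?S" using est_m setsS by (simp cong: measurable_cong_sets)
      have dev_m [measurable]: "(\<lambda>z. clip c (z i 0)) \<in> borel_measurable ?S" if "i < n" for i
        using that by (intro measurable_compose[OF measurable_component_singleton[where M="\<lambda>_. R"] compR]) simp
      have "(\<integral>\<^sup>+z. ennreal (l \<bar>est z - \<theta> P\<bar>) \<partial>?S) \<le> ennreal ((1 + 8 * a\<^sup>2 / (2 * a - 1)) * a ^ N * l w)"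
      proof (rule nn_integral_loss_le[OF assms(9,10,13) a w N(1) N2 S])
        show "(\<lambda>z. \<bar>est z - \<theta> P\<bar>) \<in> borel_measurable ?S" by measurable
        fix \<tau> :: real assume \<tau>: "0 \<le> \<tau>"
        \<comment> \<open>Triangle inequality: the bias accounts for at most
          \<open>3 / 4 * w\<close> of the error, so at least \<open>\<tau> * w\<close> must come
          from the random fluctuation.\<close>
        have sub: "{z \<in> space ?S. (3 / 4 + \<tau>) * w \<le> \<bar>est z - \<theta> P\<bar>}
          \<subseteq> {z \<in> space ?S. \<tau> * w \<le> \<bar>(\<Sum>i<n. clip c (z i 0)) / real n - (\<integral>z. clip c (z 0) \<partial>R)\<bar>}"
        proof clarsimp
          have shift: "t \<le> \<bar>s - e\<bar>"
            if "3 / 4 * w + t \<le> \<bar>c\<^sub>0 + s - \<theta> P\<bar>" "\<bar>\<theta> P - e - c\<^sub>0\<bar> \<le> (w + w / 2) / 2" for s e t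
          proof -
            have "\<bar>c\<^sub>0 + s - \<theta> P\<bar> \<le> \<bar>s - e\<bar> + \<bar>\<theta> P - e - c\<^sub>0\<bar>" by simp
            moreover have "(w + w / 2) / 2 = 3 / 4 * w" by simp
            ultimately show ?thesis using that by linarith
          qed
          fix z assume "(3 / 4 + \<tau>) * w \<le> \<bar>est z - \<theta> P\<bar>"
          then show "\<tau> * w \<le> \<bar>(\<Sum>i<n. clip c (z i 0)) / real n - (\<integral>z. clip c (z 0) \<partial>R)\<bar>"
            using bias[OF P] unfolding mean est_def distrib_right by (rule shift)
        qed
        interpret S: prob_space ?S by (rule S)
        have "measure ?S {z \<in> space ?S. (3 / 4 + \<tau>) * w \<le> \<bar>est z - \<theta> P\<bar>}
          \<le> measure ?S {z \<in> space ?S. \<tau> * w \<le> \<bar>(\<Sum>i<n. clip c (z i 0)) / real n - (\<integral>z. clip c (z 0) \<partial>R)\<bar>}"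
          by (rule S.finite_measure_mono[OF sub]) measurable
        also have "\<dots> \<le> 2 * exp (- (real n * (\<tau> * w)\<^sup>2 / (2 * c\<^sup>2)))"
          using \<tau> w c abs_clip_le by (intro iid_mean_deviation[OF R(1) compR c _ n]) auto
        \<comment> \<open>The privacy factor \<rho> in \<open>c = B * \<rho>\<close> cancels against
          the one in \<epsilon>, leaving \<open>c = w * sqrt (real n) / 8\<close>; the 8 is twice
          the factor 4 in \<epsilon>, and \<open>64 / 2 = 32\<close>.\<close>
        also have "real n * (\<tau> * w)\<^sup>2 / (2 * c\<^sup>2) = 32 * \<tau>\<^sup>2"
        proof -
          have "c = w * sqrt (real n) / 8" using \<rho> n by (simp add: c_def B_def \<epsilon>_def field_simps)
          then have "c\<^sup>2 = (w * sqrt (real n) / 8)\<^sup>2" by (rule arg_cong)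
          also have "\<dots> = w\<^sup>2 * real n / 64" by (simp add: power_divide power_mult_distrib)
          finally have c2: "c\<^sup>2 = w\<^sup>2 * real n / 64" .
          show ?thesis unfolding c2 using w n by (simp add: power_mult_distrib field_simps)
        qed
        finally show "measure ?S {z \<in> space ?S. (3 / 4 + \<tau>) * w \<le> \<bar>est z - \<theta> P\<bar>} \<le> 2 * exp (- (32 * \<tau>\<^sup>2))" .
      qed auto
      then show "(\<integral>\<^sup>+z. ennreal (l \<bar>est z - \<theta> P\<bar>) \<partial>(\<Pi>\<^sub>M i\<in>{..<n}. P \<bind> response \<alpha> B f)) \<le> ennreal (C1 * l w)"
        by (simp add: C1_def N(2) R_def)
    qed
  qed
  then show ?thesis by (simp add: w_def \<epsilon>_def \<rho>_def)
qed

end
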